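(* Let $V$ be a normal matrix ordered $*$-operator space. Then there exist a Hilbert space $H$ and a linear map $\phi:V\to B(H)$ which is a completely isometric complete order embedding: for all $n,m\in\mathbb{N}$ and $A\in M_{n,m}(V)$, $\|\phi^{(n,m)}(A)\|_{B(H^m,H^n)}=\|A\|_{n,m}$, and for all $n$ and $A\in M_n(V)$, $\phi^{(n)}(A)\ge0$ in $M_n(B(H))$ if and only if $A\in M_n(V)_+$.
   Context: A $*$-vector space is a complex vector space with a conjugate-linear involution $x\mapsto x^*$; $M_{n,m}(V)$ gets the involution $(x_{ij})^*=(x_{ji}^* )\in M_{m,n}(V)$ and $M_n(V)_{sa}$ denotes the self-adjoint elements of $M_n(V)$. An (abstract) operator space is a complex vector space $V$ with norms $\|\cdot\|_{n,m}$ on $M_{n,m}(V)$ such that $\|XAY\|_{k,l}\le\|X\|\|A\|_{n,m}\|Y\|$ for scalar $X\in M_{k,n}$, $Y\in M_{m,l}$, and $\|A\oplus B\|=\max\{\|A\|,\|B\|\}$. A $*$-operator space is an operator space which is a $*$-vector space with $\|A^*\|_{m,n}=\|A\|_{n,m}$. It is matrix ordered if for each $n$ there is a proper cone $M_n(V)_+\subseteq M_n(V)_{sa}$ such that $A\in M_n(V)_+$, $B\in M_k(V)_+$, $X\in M_{l,k}$ imply $A\oplus B\in M_{n+k}(V)_+$ and $XBX^*\in M_l(V)_+$. It is normal if for every $n$, $(M_n(V)_{sa},\|\cdot\|_{n,n},M_n(V)_+)$ is a normal ordered vector space, i.e. $M_n(V)_+$ is norm closed and $A\le B\le C$ implies $\|B\|\le\max\{\|A\|,\|C\|\}$.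 $\phi^{(n,m)}(a_{ij})=(\phi(a_{ij}))$ and $\phi^{(n)}=\phi^{(n,n)}$; $M_{n,m}(B(H))$ is identified with $B(H^m,H^n)$. *)

theory Defs
  imports "HOL-Analysis.Analysis"
begin

text \<open>An n x m matrix over V is represented as a function nat => nat => 'v which vanishes
outside the index range {0..<n} x {0..<m}.  Scalar matrices are functions nat => nat => complex,
of which only the entries in the index range are used.\<close>

definition mats :: "nat \<Rightarrow> nat \<Rightarrow> (nat \<Rightarrow> nat \<Rightarrow> 'v::zero) set" where
  "mats n m = {A. \<forall>i j. A i j \<noteq> 0 \<longrightarrow> i < n \<and> j < m}"

definition mstar :: "('v \<Rightarrow> 'v) \<Rightarrow> (nat \<Rightarrow> nat \<Rightarrow> 'v) \<Rightarrow> (nat \<Rightarrow> nat \<Rightarrow> 'v)" where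
  "mstar st A = (\<lambda>i j. st (A j i))"

definition mscale :: "(complex \<Rightarrow> 'v::ab_group_add \<Rightarrow> 'v) \<Rightarrow> complex \<Rightarrow> (nat \<Rightarrow> nat \<Rightarrow> 'v) \<Rightarrow> (nat \<Rightarrow> nat \<Rightarrow> 'v)" where
  "mscale sc c A = (\<lambda>i j. sc c (A i j))"

definition smul3 :: "(complex \<Rightarrow> 'v::ab_group_add \<Rightarrow> 'v) \<Rightarrow> nat \<Rightarrow> nat \<Rightarrow> nat \<Rightarrow> nat \<Rightarrow> (nat \<Rightarrow> nat \<Rightarrow> complex) \<Rightarrow>
    (nat \<Rightarrow> nat \<Rightarrow> 'v) \<Rightarrow> (nat \<Rightarrow> nat \<Rightarrow> complex) \<Rightarrow> (nat \<Rightarrow> nat \<Rightarrow> 'v)" where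
  "smul3 sc k n m l X A Y = (\<lambda>i j. if i < k \<and> j < l
      then (\<Sum>p<n. \<Sum>q<m. sc (X i p * Y q j) (A p q)) else 0)"

definition dsum :: "nat \<Rightarrow> nat \<Rightarrow> (nat \<Rightarrow> nat \<Rightarrow> 'v::zero) \<Rightarrow> (nat \<Rightarrow> nat \<Rightarrow> 'v) \<Rightarrow> (nat \<Rightarrow> nat \<Rightarrow> 'v)" where
  "dsum n m A B = (\<lambda>i j. if i < n \<and> j < m then A i j
                         else if n \<le> i \<and> m \<le> j then B (i - n) (j - m) else 0)"

definition cstar :: "(nat \<Rightarrow> nat \<Rightarrow> complex) \<Rightarrow> (nat \<Rightarrow> nat \<Rightarrow> complex)" where
  "cstar X = (\<lambda>i j. cnj (X j i))"

definition vnorm :: "nat \<Rightarrow> (nat \<Rightarrow> complex) \<Rightarrow> real" where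
  "vnorm n v = sqrt (\<Sum>j<n. (cmod (v j))\<^sup>2)"

definition cmat_norm :: "nat \<Rightarrow> nat \<Rightarrow> (nat \<Rightarrow> nat \<Rightarrow> complex) \<Rightarrow> real" where
  "cmat_norm k n X = Sup {vnorm k (\<lambda>i. \<Sum>j<n. X i j * v j) | v. vnorm n v \<le> 1}"

definition star_vector_space :: "(complex \<Rightarrow> 'v::ab_group_add \<Rightarrow> 'v) \<Rightarrow> ('v \<Rightarrow> 'v) \<Rightarrow> bool" where
  "star_vector_space sc st \<longleftrightarrow> vector_space sc \<and>
     (\<forall>a x y. st (sc a x + y) = sc (cnj a) (st x) + st y) \<and> (\<forall>x. st (st x) = x)"

definition operator_space :: "(complex \<Rightarrow> 'v::ab_group_add \<Rightarrow> 'v) \<Rightarrow> (nat \<Rightarrow> nat \<Rightarrow> (nat \<Rightarrow> nat \<Rightarrow> 'v) \<Rightarrow> real) \<Rightarrow> bool" where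
  "operator_space sc nrm \<longleftrightarrow> vector_space sc \<and>
     (\<forall>n m. 1 \<le> n \<longrightarrow> 1 \<le> m \<longrightarrow>
        (\<forall>A\<in>mats n m. 0 \<le> nrm n m A \<and> (nrm n m A = 0 \<longleftrightarrow> A = (\<lambda>i j. 0))) \<and>
        (\<forall>A\<in>mats n m. \<forall>c. nrm n m (mscale sc c A) = cmod c * nrm n m A) \<and>
        (\<forall>A\<in>mats n m. \<forall>B\<in>mats n m. nrm n m (\<lambda>i j. A i j + B i j) \<le> nrm n m A + nrm n m B)) \<and>
     (\<forall>k n m l X A Y. 1 \<le> k \<longrightarrow> 1 \<le> n \<longrightarrow> 1 \<le> m \<longrightarrow> 1 \<le> l \<longrightarrow> A \<in> mats n m \<longrightarrow>
        nrm k l (smul3 sc k n m l X A Y) \<le> cmat_norm k n X * nrm n m A * cmat_norm m l Y) \<and>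
     (\<forall>n m p q A B. 1 \<le> n \<longrightarrow> 1 \<le> m \<longrightarrow> 1 \<le> p \<longrightarrow> 1 \<le> q \<longrightarrow>
        A \<in> mats n m \<longrightarrow> B \<in> mats p q \<longrightarrow>
        nrm (n + p) (m + q) (dsum n m A B) = max (nrm n m A) (nrm p q B))"

definition star_operator_space ::
  "(complex \<Rightarrow> 'v::ab_group_add \<Rightarrow> 'v) \<Rightarrow> ('v \<Rightarrow> 'v) \<Rightarrow> (nat \<Rightarrow> nat \<Rightarrow> (nat \<Rightarrow> nat \<Rightarrow> 'v) \<Rightarrow> real) \<Rightarrow> bool" where
  "star_operator_space sc st nrm \<longleftrightarrow> operator_space sc nrm \<and> star_vector_space sc st \<and>
     (\<forall>n m. 1 \<le> n \<longrightarrow> 1 \<le> m \<longrightarrow> (\<forall>A\<in>mats n m. nrm m n (mstar st A) = nrm n m A))"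

definition sa_mats :: "('v::zero \<Rightarrow> 'v) \<Rightarrow> nat \<Rightarrow> (nat \<Rightarrow> nat \<Rightarrow> 'v) set" where
  "sa_mats st n = {A \<in> mats n n. mstar st A = A}"

definition proper_cone :: "(complex \<Rightarrow> 'v::ab_group_add \<Rightarrow> 'v) \<Rightarrow> (nat \<Rightarrow> nat \<Rightarrow> 'v) set \<Rightarrow> bool" where
  "proper_cone sc C \<longleftrightarrow> (\<lambda>i j. 0) \<in> C \<and> (\<forall>A\<in>C. \<forall>B\<in>C. (\<lambda>i j. A i j + B i j) \<in> C) \<and>
     (\<forall>A\<in>C. \<forall>t::real. 0 \<le> t \<longrightarrow> mscale sc (complex_of_real t) A \<in> C) \<and>
     (\<forall>A\<in>C. (\<lambda>i j. - A i j) \<in> C \<longrightarrow> A = (\<lambda>i j. 0))"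

definition matrix_ordered ::
  "(complex \<Rightarrow> 'v::ab_group_add \<Rightarrow> 'v) \<Rightarrow> ('v \<Rightarrow> 'v) \<Rightarrow> (nat \<Rightarrow> nat \<Rightarrow> (nat \<Rightarrow> nat \<Rightarrow> 'v) \<Rightarrow> real) \<Rightarrow>
   (nat \<Rightarrow> (nat \<Rightarrow> nat \<Rightarrow> 'v) set) \<Rightarrow> bool" where
  "matrix_ordered sc st nrm pos \<longleftrightarrow> star_operator_space sc st nrm \<and>
     (\<forall>n. 1 \<le> n \<longrightarrow> proper_cone sc (pos n) \<and> pos n \<subseteq> sa_mats st n) \<and>
     (\<forall>n k A B. 1 \<le> n \<longrightarrow> 1 \<le> k \<longrightarrow> A \<in> pos n \<longrightarrow> B \<in> pos k \<longrightarrow> dsum n n A B \<in> pos (n + k)) \<and>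
     (\<forall>l k X B. 1 \<le> l \<longrightarrow> 1 \<le> k \<longrightarrow> B \<in> pos k \<longrightarrow> smul3 sc l k k l X B (cstar X) \<in> pos l)"

definition normal_mo_star_opspace ::
  "(complex \<Rightarrow> 'v::ab_group_add \<Rightarrow> 'v) \<Rightarrow> ('v \<Rightarrow> 'v) \<Rightarrow> (nat \<Rightarrow> nat \<Rightarrow> (nat \<Rightarrow> nat \<Rightarrow> 'v) \<Rightarrow> real) \<Rightarrow>
   (nat \<Rightarrow> (nat \<Rightarrow> nat \<Rightarrow> 'v) set) \<Rightarrow> bool" where
  "normal_mo_star_opspace sc st nrm pos \<longleftrightarrow> matrix_ordered sc st nrm pos \<and>
     (\<forall>n. 1 \<le> n \<longrightarrow>
        (\<forall>f B. (\<forall>k. f k \<in> pos n) \<longrightarrow> B \<in> sa_mats st n \<longrightarrow>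
               (\<lambda>k. nrm n n (\<lambda>i j. f k i j - B i j)) \<longlonglongrightarrow> 0 \<longrightarrow> B \<in> pos n) \<and>
        (\<forall>A\<in>sa_mats st n. \<forall>B\<in>sa_mats st n. \<forall>C\<in>sa_mats st n.
           (\<lambda>i j. B i j - A i j) \<in> pos n \<longrightarrow> (\<lambda>i j. C i j - B i j) \<in> pos n \<longrightarrow> nrm n n B \<le> max (nrm n n A) (nrm n n C)))"

definition l2 :: "'i set \<Rightarrow> ('i \<Rightarrow> complex) set" where
  "l2 I = {x. (\<forall>i. i \<notin> I \<longrightarrow> x i = 0) \<and> (\<lambda>i. (cmod (x i))\<^sup>2) summable_on I}"

definition l2inner :: "'i set \<Rightarrow> ('i \<Rightarrow> complex) \<Rightarrow> ('i \<Rightarrow> complex) \<Rightarrow> complex" where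
  "l2inner I x y = infsum (\<lambda>i. x i * cnj (y i)) I"

definition l2norm :: "'i set \<Rightarrow> ('i \<Rightarrow> complex) \<Rightarrow> real" where
  "l2norm I x = sqrt (infsum (\<lambda>i. (cmod (x i))\<^sup>2) I)"

text \<open>Bounded linear operators on l2(I) (only their action on l2(I) is relevant).\<close>
definition bounded_op :: "'i set \<Rightarrow> (('i \<Rightarrow> complex) \<Rightarrow> ('i \<Rightarrow> complex)) \<Rightarrow> bool" where
  "bounded_op I T \<longleftrightarrow> (\<forall>x\<in>l2 I. T x \<in> l2 I) \<and>
     (\<forall>x\<in>l2 I. \<forall>y\<in>l2 I. \<forall>c. T (\<lambda>i. c * x i + y i) = (\<lambda>i. c * T x i + T y i)) \<and>
     (\<exists>K. \<forall>x\<in>l2 I. l2norm I (T x) \<le> K * l2norm I x)"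

definition opmat_apply :: "nat \<Rightarrow> (nat \<Rightarrow> nat \<Rightarrow> (('i \<Rightarrow> complex) \<Rightarrow> ('i \<Rightarrow> complex))) \<Rightarrow>
    (nat \<Rightarrow> 'i \<Rightarrow> complex) \<Rightarrow> (nat \<Rightarrow> 'i \<Rightarrow> complex)" where
  "opmat_apply m T x = (\<lambda>i t. \<Sum>j<m. T i j (x j) t)"

definition hn_norm :: "'i set \<Rightarrow> nat \<Rightarrow> (nat \<Rightarrow> 'i \<Rightarrow> complex) \<Rightarrow> real" where
  "hn_norm I n x = sqrt (\<Sum>j<n. (l2norm I (x j))\<^sup>2)"

definition opmat_norm :: "'i set \<Rightarrow> nat \<Rightarrow> nat \<Rightarrow> (nat \<Rightarrow> nat \<Rightarrow> (('i \<Rightarrow> complex) \<Rightarrow> ('i \<Rightarrow> complex))) \<Rightarrow> real" where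
  "opmat_norm I n m T = Sup {hn_norm I n (opmat_apply m T x) | x.
        (\<forall>j<m. x j \<in> l2 I) \<and> hn_norm I m x \<le> 1}"

definition opmat_pos :: "'i set \<Rightarrow> nat \<Rightarrow> (nat \<Rightarrow> nat \<Rightarrow> (('i \<Rightarrow> complex) \<Rightarrow> ('i \<Rightarrow> complex))) \<Rightarrow> bool" where
  "opmat_pos I n T \<longleftrightarrow> (\<forall>x. (\<forall>j<n. x j \<in> l2 I) \<longrightarrow>
      (let z = (\<Sum>i<n. l2inner I (opmat_apply n T x i) (x i)) in Im z = 0 \<and> 0 \<le> Re z))"

definition linear_into_B :: "(complex \<Rightarrow> 'v::ab_group_add \<Rightarrow> 'v) \<Rightarrow> 'i set \<Rightarrow> ('v \<Rightarrow> (('i \<Rightarrow> complex) \<Rightarrow> ('i \<Rightarrow> complex))) \<Rightarrow> bool" where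
  "linear_into_B sc I \<phi> \<longleftrightarrow> (\<forall>v. bounded_op I (\<phi> v)) \<and>
     (\<forall>a v w. \<forall>x\<in>l2 I. \<phi> (sc a v + w) x = (\<lambda>t. a * \<phi> v x t + \<phi> w x t))"

end

theory Submission
  imports Defs "HOL-Library.Function_Algebras"
begin

text \<open>It suffices to find, for every self-adjoint \<open>A\<close> in \<open>M\<^sub>n(V)\<close>, completely contractive and
  completely positive maps from V to matrix algebras that recover the norm of \<open>A\<close> and detect
  whether \<open>A\<close> is positive; their direct sum acts on \<open>l\<^sup>2\<close> of the set of all matrix coordinates, and
  non-self-adjoint \<open>A\<close> is replaced by the matrix with off-diagonal blocks \<open>A\<close> and \<open>A\<^sup>*\<close>.

  Consider pairs \<open>(h, y)\<close> of a scalar matrix and a matrix over V, and let \<open>gauge (h, y)\<close> be the infimum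
  of all \<open>t \<ge> 0\<close> such that \<open>y \<le> \<alpha> x \<alpha>\<^sup>*\<close> and \<open>h + \<alpha> \<alpha>\<^sup>* \<le> t\<close> for some scalar \<open>\<alpha>\<close> and self-adjoint
  contraction \<open>x\<close>. It is sublinear because \<open>\<alpha> x \<alpha>\<^sup>* + \<beta> z \<beta>\<^sup>*\<close> is the compression of \<open>x \<oplus> z\<close> by the row
  \<open>(\<alpha> \<beta>)\<close>. Normality says that \<open>\<parallel>A\<parallel>\<close> is at most the maximum of \<open>gauge (0, A)\<close> and
  \<open>gauge (0, -A)\<close>, and closedness of the cone says that \<open>gauge (0, -A) = 0\<close> forces \<open>A \<ge> 0\<close>. A
  linear functional below the gauge that attains it at \<open>(0, A)\<close> is a pair \<open>(p, F)\<close> with \<open>F\<close> positive,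
  \<open>p(1) \<le> 1\<close> and \<open>F(\<alpha> x \<alpha>\<^sup>*) \<le> p(\<alpha> \<alpha>\<^sup>*)\<close>. Hence \<open>p\<close> makes \<open>\<complex>\<^sup>n\<close> a semi-inner product space, and the
  matrix of the form \<open>(a, b) \<mapsto> F(a v b\<^sup>*)\<close> in an orthonormal basis of it is the required map.\<close>


section \<open>Hahn-Banach for sublinear functionals\<close>

text \<open>Homogeneity is asked only as an inequality: applied with \<open>1/c\<close> it gives the
  converse for \<open>c > 0\<close>, and subadditivity together with \<open>c = 0\<close> gives
  \<open>q 0 = 0\<close>.\<close>

definition sublinear :: "(real \<Rightarrow> 'b \<Rightarrow> 'b) \<Rightarrow> ('b::ab_group_add \<Rightarrow> real) \<Rightarrow> bool" where
  "sublinear s q \<longleftrightarrow> (\<forall>x y. q (x + y) \<le> q x + q y) \<and> (\<forall>c\<ge>0. \<forall>x. q (s c x) \<le> c * q x)"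

context
  fixes s :: "real \<Rightarrow> 'b::ab_group_add \<Rightarrow> 'b"
  assumes vs: "vector_space s"
begin

interpretation vector_space s by (rule vs)

lemma sublinear_zero: "sublinear s q \<Longrightarrow> q 0 = 0"
proof -
  assume q: "sublinear s q"
  have "q (0 + 0) \<le> q 0 + q 0" using q unfolding sublinear_def by blast
  moreover have "q (s 0 0) \<le> 0 * q 0" using q unfolding sublinear_def by blast
  ultimately show ?thesis by simp
qed

lemma sublinear_scale:
  assumes q: "sublinear s q" and c: "0 \<le> c"
  shows "q (s c x) = c * q x"
proof (cases "c = 0")
  case True
  then show ?thesis using sublinear_zero[OF q] by simp
next
  case False
  have "q (s (1/c) (s c x)) \<le> (1/c) * q (s c x)"
    using q c unfolding sublinear_def by (meson zero_le_divide_1_iff)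
  then have "c * q x \<le> q (s c x)" using False c by (simp add: field_simps)
  moreover have "q (s c x) \<le> c * q x" using q c unfolding sublinear_def by blast
  ultimately show ?thesis by simp
qed

lemma sublinear_uminus: "sublinear s q \<Longrightarrow> - q (- x) \<le> q x"
  using sublinear_zero[of q] unfolding sublinear_def
  by (metis add.right_inverse diff_0 diff_le_eq)

text \<open>Moving along the ray through \<open>a\<close> and subtracting the cost
  \<open>t * q a\<close> leaves a sublinear functional; \<open>t = 1\<close> at \<open>- a\<close>
  gives the stated value. It serves twice: to keep the value at \<open>a\<close> when passing to a
  minimal functional, and to show that minimal ones are odd.\<close>

lemma sublinear_lower:
  assumes q: "sublinear s q"
  shows "\<exists>m. sublinear s m \<and> (\<forall>x. m x \<le> q x) \<and> m (- a) \<le> - q a"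
proof -
  define S where "S x = {q (x + s t a) - t * q a | t. 0 \<le> t}" for x
  define m where "m x = Inf (S x)" for x
  \<comment> \<open>This bound does not depend on \<open>t\<close>, so the infimum defining
    \<open>m\<close> is finite.\<close>
  have lower: "- q (- x) \<le> u" if u: "u \<in> S x" for x u
  proof -
    obtain t where t: "0 \<le> t" "u = q (x + s t a) - t * q a" using u by (auto simp: S_def)
    have "q ((x + s t a) + (- x)) \<le> q (x + s t a) + q (- x)" using q unfolding sublinear_def by blast
    then show ?thesis using t sublinear_scale[OF q, of t a] by simp
  qed
  then have bdd: "bdd_below (S x)" for x by (meson bdd_below.I)
  have ne: "S x \<noteq> {}" for x unfolding S_def by auto
  have m_le: "m x \<le> q (x + s t a) - t * q a" if "0 \<le> t" for x t
    unfolding m_def by (rule cInf_lower[OF _ bdd]) (use that in \<open>auto simp: S_def\<close>)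
  have sub: "m (x + y) \<le> m x + m y" for x y
  proof -
    \<comment> \<open>The infimum over \<open>t\<close> is taken for fixed \<open>t'\<close>, then
      the one over \<open>t'\<close>.\<close>
    have "m (x + y) - q (y + s t' a) + t' * q a \<le> m x" if t': "0 \<le> t'" for t'
      unfolding m_def[of x]
    proof (rule cInf_greatest[OF ne])
      fix u assume "u \<in> S x"
      then obtain t where t: "0 \<le> t" "u = q (x + s t a) - t * q a" by (auto simp: S_def)
      have "m (x + y) \<le> q (x + y + s (t + t') a) - (t + t') * q a" using m_le t t' by simp
      also have "x + y + s (t + t') a = (x + s t a) + (y + s t' a)"
        by (simp add: scale_left_distrib algebra_simps)
      also have "q \<dots> \<le> q (x + s t a) + q (y + s t' a)" using q unfolding sublinear_def by blast
      finally show "m (x + y) - q (y + s t' a) + t' * q a \<le> u" using t by (simp add: algebra_simps)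
    qed
    then have *: "m (x + y) - m x \<le> q (y + s t' a) - t' * q a" if t': "0 \<le> t'" for t'
      using t' by (simp add: algebra_simps)
    have "m (x + y) - m x \<le> m y"
      unfolding m_def[of y] by (rule cInf_greatest[OF ne]) (use * in \<open>auto simp: S_def\<close>)
    then show ?thesis by simp
  qed
  have hom: "m (s c x) \<le> c * m x" if c: "0 \<le> c" for c x
  proof (cases "c = 0")
    case True
    then show ?thesis using m_le[of 0 "s c x"] sublinear_zero[OF q] by simp
  next
    case False
    then have c': "0 < c" using c by simp
    have "m (s c x) / c \<le> m x"
      unfolding m_def[of x]
    proof (rule cInf_greatest[OF ne])
      fix u assume "u \<in> S x"
      then obtain t where t: "0 \<le> t" "u = q (x + s t a) - t * q a" by (auto simp: S_def)
      have "m (s c x) \<le> q (s c x + s (c * t) a) - (c * t) * q a" using m_le c t by simp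
      also have "s c x + s (c * t) a = s c (x + s t a)"
        by (simp add: scale_right_distrib)
      also have "q \<dots> = c * q (x + s t a)" using sublinear_scale[OF q c] .
      finally have "m (s c x) \<le> c * u" unfolding t(2) by (simp add: algebra_simps)
      then show "m (s c x) / c \<le> u" using c' by (simp add: field_simps)
    qed
    then show ?thesis using c' by (simp add: field_simps)
  qed
  have "m x \<le> q x" for x using m_le[of 0 x] by simp
  moreover have "m (- a) \<le> - q a" using m_le[of 1 "- a"] sublinear_zero[OF q] by simp
  ultimately show ?thesis using sub hom unfolding sublinear_def by blast
qed

text \<open>Zorn's lemma for the sublinear functionals below \<open>q\<close>: the pointwise infimum
  of a chain is again sublinear.\<close>

lemma sublinear_minimal:
  assumes q: "sublinear s q"
  shows "\<exists>m. sublinear s m \<and> (\<forall>x. m x \<le> q x) \<and> (\<forall>f. sublinear s f \<longrightarrow> (\<forall>x. f x \<le> m x) \<longrightarrow> f = m)"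
proof -
  define A where "A = {m. sublinear s m \<and> (\<forall>x. m x \<le> q x)}"
  \<comment> \<open>The order is reversed, so the upper bound that Zorn's lemma wants for a chain is
    a pointwise lower bound.\<close>
  define P where "P f g \<longleftrightarrow> (\<forall>x. g x \<le> f x)" for f g :: "'b \<Rightarrow> real"
  have "\<exists>m\<in>A. \<forall>a\<in>A. P m a \<longrightarrow> a = m"
  proof (rule predicate_Zorn)
    show "partial_order_on A (relation_of P A)"
      unfolding P_def
      by (rule partial_order_on_relation_ofI) (blast, meson order_trans, metis antisym ext)
  next
    fix C assume C: "C \<in> Chains (relation_of P A)"
    then have CA: "C \<subseteq> A" and tot: "\<And>f g. f \<in> C \<Longrightarrow> g \<in> C \<Longrightarrow> P f g \<or> P g f"
      unfolding Chains_def relation_of_def by auto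
    show "\<exists>u\<in>A. \<forall>a\<in>C. P a u"
    proof (cases "C = {}")
      case True
      then show ?thesis using q unfolding A_def by auto
    next
      case False
      define u where "u x = (INF f\<in>C. f x)" for x
      \<comment> \<open>Since \<open>f\<close> is below \<open>q\<close>, \<open>f x\<close> \<ge>
        \<open>- f (- x)\<close> \<ge> \<open>- q (- x)\<close>; this keeps \<open>u\<close>
        finite.\<close>
      have lower: "- q (- x) \<le> f x" if "f \<in> C" for f x
        using that CA sublinear_uminus[of f x] unfolding A_def
        by (smt (verit, best) mem_Collect_eq subsetD)
      have bdd: "bdd_below ((\<lambda>f. f x) ` C)" for x by (rule bdd_belowI2[OF lower])
      have ule: "u x \<le> f x" if "f \<in> C" for f x unfolding u_def by (rule cINF_lower[OF bdd that])
      have sub: "u (x + y) \<le> u x + u y" for x y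
      proof -
        \<comment> \<open>Comparability within the chain lets the smaller of \<open>f\<close> and
          \<open>g\<close> be used at both points.\<close>
        have *: "u (x + y) \<le> f x + g y" if fg: "f \<in> C" "g \<in> C" for f g
        proof -
          have f: "f (x + y) \<le> f x + f y" "g (x + y) \<le> g x + g y"
            using fg CA unfolding A_def sublinear_def by blast+
          from tot[OF fg] show ?thesis
          proof
            assume "P f g"
            then have "g x \<le> f x" unfolding P_def by blast
            then show ?thesis using f ule[OF fg(2), of "x+y"] by linarith
          next
            assume "P g f"
            then have "f y \<le> g y" unfolding P_def by blast
            then show ?thesis using f ule[OF fg(1), of "x+y"] by linarith
          qed
        qed
        have "u (x + y) - g y \<le> u x" if "g \<in> C" for g
          unfolding u_def[of x] by (rule cINF_greatest[OF False]) (use *[OF _ that] in \<open>smt (verit)\<close>)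
        then have "u (x + y) - u x \<le> u y"
          unfolding u_def[of y] by (intro cINF_greatest[OF False]) (smt (verit))
        then show ?thesis by simp
      qed
      have hom: "u (s c x) \<le> c * u x" if c: "0 \<le> c" for c x
      proof (cases "c = 0")
        case True
        obtain f where f: "f \<in> C" using False by blast
        then have "f 0 = 0" using CA sublinear_zero unfolding A_def by blast
        then show ?thesis using ule[OF f, of 0] True by simp
      next
        case c0: False
        have "u (s c x) / c \<le> u x"
          unfolding u_def[of x]
        proof (rule cINF_greatest[OF False])
          fix f assume f: "f \<in> C"
          then have "f (s c x) \<le> c * f x" using CA c unfolding A_def sublinear_def by blast
          then show "u (s c x) / c \<le> f x" using ule[OF f, of "s c x"] c c0 by (simp add: field_simps)
        qed
        then show ?thesis using c c0 by (simp add: field_simps)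
      qed
      obtain f where f: "f \<in> C" using False by blast
      then have "u x \<le> q x" for x
        using ule[OF f, of x] CA unfolding A_def by (auto dest!: subsetD intro: order_trans)
      then have "u \<in> A" unfolding A_def sublinear_def using sub hom by blast
      then show ?thesis using ule unfolding P_def by blast
    qed
  qed
  then obtain m where m: "m \<in> A" and min: "\<And>f. f \<in> A \<Longrightarrow> P m f \<Longrightarrow> f = m" by blast
  have "f = m" if f: "sublinear s f" "\<forall>x. f x \<le> m x" for f
    by (rule min) (use f m in \<open>auto simp: A_def P_def intro: order_trans\<close>)
  then show ?thesis using m unfolding A_def by blast
qed

text \<open>A minimal sublinear functional is odd, by \<open>sublinear_lower\<close>, hence linear.\<close>
theorem hahn_banach_sublinear:
  assumes q: "sublinear s q"
  obtains f where "\<And>x y. f (x + y) = f x + f y" "\<And>c x. f (s c x) = c * f x"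
    "\<And>x. f x \<le> q x" "f a = q a"
proof -
  \<comment> \<open>An odd \<open>f\<close> below \<open>q'\<close> has
    \<open>- f a = f (- a)\<close> at most \<open>- q a\<close>, which forces the value at
    \<open>a\<close>.\<close>
  obtain q' where q': "sublinear s q'" "\<And>x. q' x \<le> q x" "q' (- a) \<le> - q a"
    using sublinear_lower[OF q] by blast
  obtain f where f: "sublinear s f" "\<And>x. f x \<le> q' x"
    and min: "\<And>g. sublinear s g \<Longrightarrow> (\<forall>x. g x \<le> f x) \<Longrightarrow> g = f"
    using sublinear_minimal[OF q'(1)] by blast
  have odd: "f (- x) = - f x" for x
  proof -
    obtain g where "sublinear s g" "\<forall>y. g y \<le> f y" "g (- x) \<le> - f x"
      using sublinear_lower[OF f(1)] by blast
    then have "f (- x) \<le> - f x" using min by auto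
    then show ?thesis using sublinear_uminus[OF f(1), of x] by linarith
  qed
  have sub: "f (x + y) \<le> f x + f y" for x y using f(1) unfolding sublinear_def by blast
  have add: "f (x + y) = f x + f y" for x y
    using sub[of x y] sub[of "x + y" "- y"] odd[of y] by simp
  have scale: "f (s c x) = c * f x" for c x
  proof (cases "0 \<le> c")
    case True
    then show ?thesis using sublinear_scale[OF f(1)] by blast
  next
    case False
    then have "f (s (- c) x) = - c * f x" using sublinear_scale[OF f(1), of "- c" x] by simp
    moreover have "s (- c) x = - s c x" by simp
    ultimately show ?thesis using odd by (metis minus_mult_left neg_equal_iff_equal)
  qed
  have "f a \<ge> q a" using f(2)[of "- a"] q'(3) odd[of a] by linarith
  then have "f a = q a" using f(2)[of a] q'(2)[of a] by linarith
  moreover have "f x \<le> q x" for x using f(2)[of x] q'(2)[of x] by linarith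
  ultimately show ?thesis using that add scale by blast
qed

end

text \<open>\<open>G\<close> is the complex-linear functional with real part \<open>g\<close>.
  Splitting \<open>c\<close> into real and imaginary part reduces its homogeneity to that of
  \<open>g\<close>.\<close>

lemma complexification_linear:
  fixes sc :: "complex \<Rightarrow> 'b::ab_group_add \<Rightarrow> 'b"
  assumes "vector_space sc"
    and add: "\<And>x y. g (x + y) = g x + (g y :: real)"
    and scale: "\<And>r x. g (sc (complex_of_real r) x) = r * g x"
  defines "G \<equiv> \<lambda>y. Complex (g y) (- g (sc \<i> y))"
  shows "G (x + y) = G x + G y" "G (sc c x) = c * G x"
proof -
  interpret vector_space sc by fact
  show "G (x + y) = G x + G y"
    unfolding G_def by (simp add: add scale_right_distrib complex_eq_iff)
  have "sc c x = sc (complex_of_real (Re c)) x + sc (complex_of_real (Im c)) (sc \<i> x)"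
    by (simp add: scale_left_distrib[symmetric] complex_eq_iff)
  then have 1: "g (sc c x) = Re c * g x + Im c * g (sc \<i> x)" by (metis add scale)
  have "sc \<i> (sc c x) = sc (complex_of_real (Re c)) (sc \<i> x) + sc (complex_of_real (- Im c)) x"
    unfolding scale_scale scale_left_distrib[symmetric] by (rule arg_cong[of _ _ "\<lambda>c. sc c x"]) (simp add: complex_eq_iff)
  then have 2: "g (sc \<i> (sc c x)) = Re c * g (sc \<i> x) + - Im c * g x"
    by (metis add scale)
  show "G (sc c x) = c * G x"
    unfolding G_def 1 2 by (simp add: complex_eq_iff algebra_simps)
qed

section \<open>Positive semidefinite forms\<close>

text \<open>A form that may be degenerate, since the functional behind it may vanish on nonzero
  positive matrices.\<close>

locale semi_inner =
  fixes P :: "(nat \<Rightarrow> complex) \<Rightarrow> (nat \<Rightarrow> complex) \<Rightarrow> complex"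
  assumes P_add: "P (\<lambda>t. a t + b t) z = P a z + P b z"
    and P_scale: "P (\<lambda>t. c * a t) z = c * P a z"
    and P_cnj: "P b a = cnj (P a b)"
    and P_nonneg: "0 \<le> Re (P a a)"
begin

lemma P_add_right: "P z (\<lambda>t. a t + b t) = P z a + P z b"
  by (metis P_add P_cnj complex_cnj_add)

lemma P_scale_right: "P z (\<lambda>t. c * a t) = cnj c * P z a"
  by (metis P_scale P_cnj complex_cnj_mult)

lemma P_zero: "P (\<lambda>t. 0) z = 0" "P z (\<lambda>t. 0) = 0"
  using P_scale[of 0 "\<lambda>t. 0" z] P_scale_right[of z 0 "\<lambda>t. 0"] by simp_all

lemma P_sum: "P (\<lambda>t. \<Sum>r<d. c r * u r t) z = (\<Sum>r<(d::nat). c r * P (u r) z)"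
  by (induction d) (simp_all add: P_zero P_add P_scale)

lemma P_sum_right: "P z (\<lambda>t. \<Sum>r<d. c r * u r t) = (\<Sum>r<(d::nat). cnj (c r) * P z (u r))"
  by (induction d) (simp_all add: P_zero P_add_right P_scale_right)

lemma P_self_real: "Im (P a a) = 0"
  using P_cnj[of a a] by (simp add: complex_eq_iff)

text \<open>Otherwise moving \<open>x\<close> along \<open>z\<close> would change
  \<open>P x x\<close> linearly and make it negative.\<close>

lemma P_null: 
  assumes "Re (P z z) = 0"
  shows "P z x = 0"
proof (rule ccontr)
  assume n: "P z x \<noteq> 0"
  \<comment> \<open>Chosen so that \<open>c * P z x\<close> is \<open>- (P x x + 1)\<close>, which
    turns the square length into \<open>- P x x - 2\<close>.\<close>
  define c where "c = - of_real (Re (P x x) + 1) * cnj (P z x) / of_real ((cmod (P z x))\<^sup>2)"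
  have "c * P z x = - of_real (Re (P x x) + 1)"
    using n unfolding c_def complex_norm_square by (simp add: field_simps)
  moreover have "P (\<lambda>t. x t + c * z t) (\<lambda>t. x t + c * z t)
      = P x x + c * P z x + cnj (c * P z x) + c * cnj c * P z z"
    using P_cnj[of z x] by (simp add: P_add P_add_right P_scale P_scale_right algebra_simps)
  moreover have "P z z = 0" using assms P_self_real by (simp add: complex_eq_iff)
  ultimately have "Re (P (\<lambda>t. x t + c * z t) (\<lambda>t. x t + c * z t)) = Re (P x x) - 2 * (Re (P x x) + 1)"
    by simp
  then have "0 \<le> Re (P x x) - 2 * (Re (P x x) + 1)" using P_nonneg by metis
  then show False using P_nonneg[of x] by simp
qed

text \<open>The form may be degenerate, so vectors are expanded only up to a null remainder
  \<open>z\<close>. In the induction the remainder of the next vector is either null and kept, or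
  normalised and appended to the family.\<close>

lemma gram_schmidt:
  "\<exists>(d::nat) u. (\<forall>r<d. \<forall>s<d. P (u r) (u s) = (if r = s then 1 else 0)) \<and>
     (\<forall>i<n. \<exists>c z. e i = (\<lambda>t. (\<Sum>r<d. c r * u r t) + z t) \<and> Re (P z z) = 0)"
  for n :: nat
proof (induction n)
  case 0
  show ?case by (rule exI[of _ 0]) simp
next
  case (Suc n)
  then obtain d :: nat and u where on: "\<forall>r<d. \<forall>s<d. P (u r) (u s) = (if r = s then 1 else 0)"
    and ex: "\<forall>i<n. \<exists>c z. e i = (\<lambda>t. (\<Sum>r<d. c r * u r t) + z t) \<and> Re (P z z) = 0" by blast
  define c where "c r = P (e n) (u r)" for r
  define w where "w = (\<lambda>t. e n t + (-1) * (\<Sum>r<d. c r * u r t))"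
  have en: "e n = (\<lambda>t. (\<Sum>r<d. c r * u r t) + w t)" unfolding w_def by auto
  have orth: "P w (u s) = 0" if "s < d" for s
  proof -
    have "P w (u s) = P (e n) (u s) - (\<Sum>r<d. c r * P (u r) (u s))"
      unfolding w_def P_add P_scale P_sum by simp
    also have "(\<Sum>r<d. c r * P (u r) (u s)) = (\<Sum>r<d. if r = s then c r else 0)"
      by (rule sum.cong) (use on that in auto)
    also have "\<dots> = c s" using that by simp
    finally show ?thesis by (simp add: c_def)
  qed
  show ?case
  proof (cases "Re (P w w) = 0")
    case True
    have "\<exists>c z. e i = (\<lambda>t. (\<Sum>r<d. c r * u r t) + z t) \<and> Re (P z z) = 0" if "i < Suc n" for i
      using that ex en True by (cases "i = n") (blast, simp add: less_Suc_eq)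
    then show ?thesis using on by blast
  next
    case False
    define l where "l = sqrt (Re (P w w))"
    have pos: "0 < Re (P w w)" using False P_nonneg[of w] by linarith
    then have l: "0 < l" "l\<^sup>2 = Re (P w w)" unfolding l_def by simp_all
    define v where "v = (\<lambda>t. of_real (1/l) * w t)"
    have Pww: "P w w = of_real (l\<^sup>2)" using l P_self_real by (simp add: complex_eq_iff)
    have vv: "P v v = 1" unfolding v_def P_scale P_scale_right Pww using l(1) by (simp add: power2_eq_square)
    have vu: "P v (u s) = 0" "P (u s) v = 0" if "s < d" for s
      using orth[OF that] P_cnj[of "u s" w] unfolding v_def P_scale P_scale_right by simp_all
    define u' where "u' = u(d := v)"
    have on': "\<forall>r<Suc d. \<forall>s<Suc d. P (u' r) (u' s) = (if r = s then 1 else 0)"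
      unfolding u'_def using on vv vu by (auto simp: less_Suc_eq)
    have "\<exists>c z. e i = (\<lambda>t. (\<Sum>r<Suc d. c r * u' r t) + z t) \<and> Re (P z z) = 0" if i: "i < Suc n" for i
    proof (cases "i = n")
      case True
      \<comment> \<open>Since \<open>w\<close> is \<open>l\<close> times the new vector
        \<open>v\<close>, the new coefficient is \<open>l\<close> and nothing remains.\<close>
      have "e i = (\<lambda>t. (\<Sum>r<Suc d. (c(d := of_real l)) r * u' r t) + 0)"
        unfolding True using l(1) by (subst en) (auto simp: u'_def v_def field_simps)
      then show ?thesis using P_zero by (intro exI[of _ "c(d := of_real l)"] exI[of _ "\<lambda>t. 0"]) simp
    next
      case False
      then obtain b z where bz: "e i = (\<lambda>t. (\<Sum>r<d. b r * u r t) + z t)" "Re (P z z) = 0"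
        using i ex by (metis less_SucE)
      have "e i = (\<lambda>t. (\<Sum>r<Suc d. (b(d := 0)) r * u' r t) + z t)"
        unfolding bz(1) by (auto simp: u'_def)
      then show ?thesis using bz(2) by blast
    qed
    then show ?thesis using on' by blast
  qed
qed

end

section \<open>Finite sums and operator norms of scalar matrices\<close>

lemma sum_lessThan_add:
  fixes f :: "nat \<Rightarrow> 'a::comm_monoid_add"
  shows "(\<Sum>p<a + b. f p) = (\<Sum>p<a. f p) + (\<Sum>p<b. f (a + p))"
  by (induction b) (simp_all add: add.assoc)

lemma cmod_sum_mult_le:
  "(cmod (\<Sum>i<n. f i * g i))\<^sup>2 \<le> (\<Sum>i<n. (cmod (f i))\<^sup>2) * (\<Sum>i<(n::nat). (cmod (g i))\<^sup>2)"
proof -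
  have "cmod (\<Sum>i<n. f i * g i) \<le> (\<Sum>i<n. cmod (f i) * cmod (g i))"
    by (rule order_trans[OF norm_sum]) (simp add: norm_mult)
  then have "(cmod (\<Sum>i<n. f i * g i))\<^sup>2 \<le> (\<Sum>i<n. cmod (f i) * cmod (g i))\<^sup>2"
    by (rule power_mono) simp
  also have "\<dots> \<le> (\<Sum>i<n. (cmod (f i))\<^sup>2) * (\<Sum>i<n. (cmod (g i))\<^sup>2)"
    by (rule Cauchy_Schwarz_ineq_sum)
  finally show ?thesis .
qed

text \<open>\<open>cmat_norm\<close> is a supremum of reals, so the first claim needs a nonempty set
  and the second a bounded one; the zero vector and \<open>c\<close> provide this.\<close>

lemma cmat_norm_bounds:
  assumes c: "0 \<le> c" and X: "\<And>v. (\<Sum>i<k. (cmod (\<Sum>j<n. X i j * v j))\<^sup>2) \<le> c\<^sup>2 * (\<Sum>j<n. (cmod (v j))\<^sup>2)"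
  shows "cmat_norm k n X \<le> c" "0 \<le> cmat_norm k n X"
proof -
  define S where "S = {vnorm k (\<lambda>i. \<Sum>j<n. X i j * v j) | v. vnorm n v \<le> 1}"
  have 0: "0 \<in> S" unfolding S_def by (rule CollectI, rule exI[of _ "\<lambda>_. 0"]) (simp add: vnorm_def)
  have le: "u \<le> c" if "u \<in> S" for u
  proof -
    from \<open>u \<in> S\<close> obtain v where v: "u = vnorm k (\<lambda>i. \<Sum>j<n. X i j * v j)" "vnorm n v \<le> 1"
      unfolding S_def by blast
    have "u \<le> sqrt (c\<^sup>2 * (\<Sum>j<n. (cmod (v j))\<^sup>2))" unfolding v(1) vnorm_def using X by simp
    also have "\<dots> = c * vnorm n v" using c by (simp add: real_sqrt_mult vnorm_def)
    also have "\<dots> \<le> c * 1" using v(2) c by (intro mult_left_mono)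
    finally show ?thesis by simp
  qed
  show "cmat_norm k n X \<le> c"
    unfolding cmat_norm_def S_def[symmetric] using 0 le by (intro cSup_least) auto
  show "0 \<le> cmat_norm k n X"
    unfolding cmat_norm_def S_def[symmetric] using 0 le by (intro cSup_upper bdd_aboveI) auto
qed

text \<open>With \<open>w = \<alpha> v\<close>, the square norm \<open>S\<close> of \<open>w\<close>
  is the inner product of \<open>v\<close> with \<open>\<alpha>^* w\<close>. Cauchy-Schwarz and the
  hypothesis give \<open>S^2 <= t S W\<close>, and \<open>S\<close> cancels.\<close>

lemma adjoint_bound:
  fixes \<alpha> :: "nat \<Rightarrow> nat \<Rightarrow> complex"
  assumes t: "0 \<le> t"
    and \<alpha>: "\<And>w. (\<Sum>p<k. (cmod (\<Sum>i<n. cnj (\<alpha> i p) * w i))\<^sup>2) \<le> t * (\<Sum>i<n. (cmod (w i))\<^sup>2)"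
  shows "(\<Sum>i<n. (cmod (\<Sum>p<k. \<alpha> i p * v p))\<^sup>2) \<le> t * (\<Sum>p<k. (cmod (v p))\<^sup>2)"
proof -
  define w where "w i = (\<Sum>p<k. \<alpha> i p * v p)" for i
  define z where "z p = (\<Sum>i<n. cnj (\<alpha> i p) * w i)" for p
  define S where "S = (\<Sum>i<n. (cmod (w i))\<^sup>2)"
  define W where "W = (\<Sum>p<k. (cmod (v p))\<^sup>2)"
  have S0: "0 \<le> S" "0 \<le> W" unfolding S_def W_def by (simp_all add: sum_nonneg)
  have "complex_of_real S = (\<Sum>i<n. \<Sum>p<k. cnj (w i) * (\<alpha> i p * v p))"
    unfolding S_def of_real_sum complex_norm_square sum_distrib_left[symmetric] w_def[symmetric]
    by (simp add: mult.commute)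
  also have "\<dots> = (\<Sum>p<k. cnj (z p) * v p)"
    unfolding z_def by (subst sum.swap) (simp add: sum_distrib_left sum_distrib_right ac_simps)
  finally have "complex_of_real S = (\<Sum>p<k. cnj (z p) * v p)" .
  then have "S\<^sup>2 = (cmod (\<Sum>p<k. cnj (z p) * v p))\<^sup>2" by (metis norm_of_real power2_abs)
  also have "\<dots> \<le> (\<Sum>p<k. (cmod (cnj (z p)))\<^sup>2) * W" unfolding W_def by (rule cmod_sum_mult_le)
  also have "\<dots> \<le> t * S * W" using \<alpha>[of w] S0 unfolding complex_mod_cnj z_def S_def by (intro mult_right_mono)
  finally have "S * S \<le> S * (t * W)" by (simp add: power2_eq_square ac_simps)
  then have "S \<le> t * W" using S0 t by (cases "S = 0") (simp_all add: mult_le_cancel_left)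
  then show ?thesis unfolding S_def W_def w_def .
qed

section \<open>The gauge of a normal matrix ordered operator space\<close>

locale normal_space =
  fixes sc :: "complex \<Rightarrow> 'v::ab_group_add \<Rightarrow> 'v"
    and st :: "'v \<Rightarrow> 'v"
    and nrm :: "nat \<Rightarrow> nat \<Rightarrow> (nat \<Rightarrow> nat \<Rightarrow> 'v) \<Rightarrow> real"
    and pos :: "nat \<Rightarrow> (nat \<Rightarrow> nat \<Rightarrow> 'v) set"
  assumes normal: "normal_mo_star_opspace sc st nrm pos"
begin

lemmas mo = normal[unfolded normal_mo_star_opspace_def, THEN conjunct1]
lemmas closed_normal = normal[unfolded normal_mo_star_opspace_def, THEN conjunct2, rule_format]
lemmas sos = mo[unfolded matrix_ordered_def, THEN conjunct1, unfolded star_operator_space_def]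
lemmas cones = mo[unfolded matrix_ordered_def, THEN conjunct2]
lemmas os = sos[THEN conjunct1, unfolded operator_space_def]
lemmas os_nrm = os[THEN conjunct2, THEN conjunct1, rule_format]
lemmas os_axioms = os[THEN conjunct2, THEN conjunct2]
lemmas svs = sos[THEN conjunct2, THEN conjunct1, unfolded star_vector_space_def]

lemma vs: "vector_space sc" using svs by blast

sublocale V: vector_space sc by (rule vs)

lemma st_lin: "st (sc a x + y) = sc (cnj a) (st x) + st y" using svs by blast
lemma st_st [simp]: "st (st x) = x" using svs by blast
lemma st_add: "st (x + y) = st x + st y" using st_lin[of 1 x y] by simp
lemma st_zero [simp]: "st 0 = 0" using st_add[of 0 0] by simp
lemma st_scale: "st (sc a x) = sc (cnj a) (st x)" using st_lin[of a x 0] by simp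
lemma st_uminus: "st (- x) = - st x" using st_add[of x "- x"] by (simp add: eq_neg_iff_add_eq_0 add.commute)
lemma st_diff: "st (x - y) = st x - st y" using st_add[of x "- y"] st_uminus[of y] by simp
lemma st_sum: "st (\<Sum>i\<in>A. f i) = (\<Sum>i\<in>A. st (f i))"
  by (induction A rule: infinite_finite_induct) (simp_all add: st_add)

context
  fixes n m :: nat
  assumes n: "1 \<le> n" and m: "1 \<le> m"
begin
lemma nrm_nonneg: "A \<in> mats n m \<Longrightarrow> 0 \<le> nrm n m A" using os_nrm[OF n m] by blast
lemma nrm_eq_0: "A \<in> mats n m \<Longrightarrow> nrm n m A = 0 \<longleftrightarrow> A = (\<lambda>i j. 0)" using os_nrm[OF n m] by blast
lemma nrm_scale: "A \<in> mats n m \<Longrightarrow> nrm n m (mscale sc c A) = cmod c * nrm n m A"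
  using os_nrm[OF n m] by blast
lemma nrm_star: "A \<in> mats n m \<Longrightarrow> nrm m n (mstar st A) = nrm n m A"
  using sos[THEN conjunct2, THEN conjunct2] n m by blast
lemma nrm_smul3: "1 \<le> k \<Longrightarrow> 1 \<le> l \<Longrightarrow> A \<in> mats n m \<Longrightarrow>
    nrm k l (smul3 sc k n m l X A Y) \<le> cmat_norm k n X * nrm n m A * cmat_norm m l Y"
  using os_axioms[THEN conjunct1] n m by blast
lemma nrm_dsum: "1 \<le> p \<Longrightarrow> 1 \<le> q \<Longrightarrow> A \<in> mats n m \<Longrightarrow> B \<in> mats p q \<Longrightarrow>
    nrm (n + p) (m + q) (dsum n m A B) = max (nrm n m A) (nrm p q B)"
  using os_axioms[THEN conjunct2] n m by blast
end

lemma pos_cone: "1 \<le> n \<Longrightarrow> proper_cone sc (pos n)" using cones by blast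
lemma pos_zero: "1 \<le> n \<Longrightarrow> (\<lambda>i j. 0) \<in> pos n"
  using pos_cone unfolding proper_cone_def by blast
lemma pos_add: "1 \<le> n \<Longrightarrow> A \<in> pos n \<Longrightarrow> B \<in> pos n \<Longrightarrow> (\<lambda>i j. A i j + B i j) \<in> pos n"
  using pos_cone unfolding proper_cone_def by blast
lemma pos_scale: "1 \<le> n \<Longrightarrow> A \<in> pos n \<Longrightarrow> 0 \<le> t \<Longrightarrow> (\<lambda>i j. sc (complex_of_real t) (A i j)) \<in> pos n"
  using pos_cone unfolding proper_cone_def mscale_def by blast
lemma pos_sa: "1 \<le> n \<Longrightarrow> A \<in> pos n \<Longrightarrow> A \<in> sa_mats st n" using cones by blast
lemma pos_conj: "1 \<le> l \<Longrightarrow> 1 \<le> k \<Longrightarrow> B \<in> pos k \<Longrightarrow> smul3 sc l k k l X B (cstar X) \<in> pos l"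
  using cones by blast
lemma pos_closed: "1 \<le> n \<Longrightarrow> (\<And>k. f k \<in> pos n) \<Longrightarrow> B \<in> sa_mats st n \<Longrightarrow>
    (\<lambda>k::nat. nrm n n (\<lambda>i j. f k i j - B i j)) \<longlonglongrightarrow> 0 \<Longrightarrow> B \<in> pos n"
  using closed_normal[THEN conjunct1, rule_format] by blast
lemma nrm_normal: "1 \<le> n \<Longrightarrow> A \<in> sa_mats st n \<Longrightarrow> B \<in> sa_mats st n \<Longrightarrow> C \<in> sa_mats st n \<Longrightarrow>
    (\<lambda>i j. B i j - A i j) \<in> pos n \<Longrightarrow> (\<lambda>i j. C i j - B i j) \<in> pos n \<Longrightarrow>
    nrm n n B \<le> max (nrm n n A) (nrm n n C)"
  using closed_normal[THEN conjunct2, rule_format] by blast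

lemma sa_mats_iff: "A \<in> sa_mats st n \<longleftrightarrow> (\<forall>i j. (i < n \<and> j < n \<or> A i j = 0) \<and> st (A j i) = A i j)"
  unfolding sa_mats_def mats_def mstar_def by (auto simp: fun_eq_iff)

lemma sa_mats_mats: "A \<in> sa_mats st n \<Longrightarrow> A \<in> mats n n"
  unfolding sa_mats_def by blast

definition sandwich :: "nat \<Rightarrow> nat \<Rightarrow> (nat \<Rightarrow> nat \<Rightarrow> complex) \<Rightarrow> (nat \<Rightarrow> nat \<Rightarrow> 'v) \<Rightarrow> nat \<Rightarrow> nat \<Rightarrow> 'v" where
  "sandwich n k \<alpha> x = smul3 sc n k k n \<alpha> x (cstar \<alpha>)"

lemma sandwich_apply: "sandwich n k \<alpha> x i j =
    (if i < n \<and> j < n then \<Sum>p<k. \<Sum>q<k. sc (\<alpha> i p * cnj (\<alpha> j q)) (x p q) else 0)"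
  unfolding sandwich_def smul3_def cstar_def by simp

lemma sandwich_sa: "x \<in> sa_mats st k \<Longrightarrow> sandwich n k \<alpha> x \<in> sa_mats st n"
  unfolding sa_mats_iff sandwich_apply
  by (auto simp: st_sum st_scale mult.commute intro!: sum.swap[THEN trans] sum.cong)

text \<open>The self-adjoint part, cut to the index range. It lets the gauge accept every
  \<open>y\<close>, so that its domain is a complex vector space.\<close>

definition herm_part :: "nat \<Rightarrow> (nat \<Rightarrow> nat \<Rightarrow> 'v) \<Rightarrow> nat \<Rightarrow> nat \<Rightarrow> 'v" where
  "herm_part n y i j = (if i < n \<and> j < n then sc (1/2) (y i j + st (y j i)) else 0)"

lemma scale_half_double: "sc (1/2) (v + v) = v"
proof -
  have "v + v = sc 2 v" using V.scale_left_distrib[of 1 1 v] by simp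
  then show ?thesis by simp
qed

lemma herm_part_sa_mats: "herm_part n y \<in> sa_mats st n"
  unfolding sa_mats_iff herm_part_def by (auto simp: st_scale st_add add.commute)

lemma herm_part_sa: "y \<in> sa_mats st n \<Longrightarrow> herm_part n y = y"
  unfolding sa_mats_iff herm_part_def by (auto simp: fun_eq_iff scale_half_double)

lemma herm_part_add: "herm_part n (y + z) = (\<lambda>i j. herm_part n y i j + herm_part n z i j)"
  unfolding herm_part_def by (auto simp: fun_eq_iff st_add V.scale_right_distrib)

lemma herm_part_scale: "herm_part n (\<lambda>i j. sc (complex_of_real c) (y i j)) = (\<lambda>i j. sc (complex_of_real c) (herm_part n y i j))"
  unfolding herm_part_def by (auto simp: fun_eq_iff st_scale V.scale_right_distrib)

text \<open>The quadratic form of the self-adjoint part of \<open>h\<close> at \<open>w\<close>;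
  upper bounds on \<open>h\<close> are tested on vectors.\<close>

definition quad_form :: "nat \<Rightarrow> (nat \<Rightarrow> nat \<Rightarrow> complex) \<Rightarrow> (nat \<Rightarrow> complex) \<Rightarrow> real" where
  "quad_form n h w = (\<Sum>i<n. \<Sum>j<n. Re (cnj (w i) * h i j * w j))"

text \<open>The square norm of \<open>\<alpha>^* w\<close>, that is, the quadratic form of
  \<open>\<alpha> \<alpha>^*\<close> at \<open>w\<close>.\<close>

definition adj_sq :: "nat \<Rightarrow> nat \<Rightarrow> (nat \<Rightarrow> nat \<Rightarrow> complex) \<Rightarrow> (nat \<Rightarrow> complex) \<Rightarrow> real" where
  "adj_sq n k \<alpha> w = (\<Sum>p<k. (cmod (\<Sum>i<n. cnj (\<alpha> i p) * w i))\<^sup>2)"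

definition vec_sq :: "nat \<Rightarrow> (nat \<Rightarrow> complex) \<Rightarrow> real" where
  "vec_sq n w = (\<Sum>i<n. (cmod (w i))\<^sup>2)"

text \<open>In matrix terms: \<open>Re y \<le> \<alpha> x \<alpha>\<^sup>*\<close> for a self-adjoint contraction \<open>x\<close> and
  \<open>Re h + \<alpha> \<alpha>\<^sup>* \<le> t\<close>. The scalar variable \<open>h\<close> is there so that a functional below the
  resulting gauge comes with a positive functional on scalar matrices that controls it.\<close>
definition feasible :: "nat \<Rightarrow> (nat \<Rightarrow> nat \<Rightarrow> complex) \<Rightarrow> (nat \<Rightarrow> nat \<Rightarrow> 'v) \<Rightarrow> real \<Rightarrow> bool" where
  "feasible n h y t \<longleftrightarrow> 0 \<le> t \<and> (\<exists>k \<alpha> x. 1 \<le> k \<and> x \<in> sa_mats st k \<and> nrm k k x \<le> 1 \<and>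
     (\<lambda>i j. sandwich n k \<alpha> x i j - herm_part n y i j) \<in> pos n \<and> (\<forall>w. quad_form n h w + adj_sq n k \<alpha> w \<le> t * vec_sq n w))"

lemma feasibleI: "\<lbrakk>0 \<le> t; 1 \<le> k; x \<in> sa_mats st k; nrm k k x \<le> 1;
     (\<lambda>i j. sandwich n k \<alpha> x i j - herm_part n y i j) \<in> pos n; \<And>w. quad_form n h w + adj_sq n k \<alpha> w \<le> t * vec_sq n w\<rbrakk>
   \<Longrightarrow> feasible n h y t"
  unfolding feasible_def by blast

lemma nrm_zero: "1 \<le> n \<Longrightarrow> nrm n n (\<lambda>i j. 0) = 0"
  using nrm_eq_0[of n n "\<lambda>i j. 0"] by (simp add: mats_def)

lemma feasible_trivial:
  assumes n: "1 \<le> n" and t: "0 \<le> t" and y: "(\<lambda>i j. - herm_part n y i j) \<in> pos n"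
    and h: "\<And>w. quad_form n h w \<le> t * vec_sq n w"
  shows "feasible n h y t"
proof -
  have "sandwich n 1 (\<lambda>i j. 0) (\<lambda>i j. 0) = (\<lambda>i j. 0)" by (simp add: fun_eq_iff sandwich_apply)
  then show ?thesis
    by (intro feasibleI[OF t, of 1 "\<lambda>i j. 0" n "\<lambda>i j. 0"])
       (use y h in \<open>simp_all add: sa_mats_iff nrm_zero adj_sq_def\<close>)
qed

lemma sa_mats_dsum:
  assumes "x \<in> sa_mats st k" "y \<in> sa_mats st l"
  shows "dsum k k x y \<in> sa_mats st (k + l)"
proof -
  have "i < k + l" "j < k + l" if "k \<le> i" "k \<le> j" "y (i - k) (j - k) \<noteq> 0" for i j
    using that assms(2) unfolding sa_mats_iff by (metis add.commute less_diff_conv2)+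
  then show ?thesis using assms unfolding sa_mats_iff dsum_def by auto
qed

lemma feasible_add:
  assumes n: "1 \<le> n" and "feasible n h y t" "feasible n h' y' t'"
  shows "feasible n (h + h') (y + y') (t + t')"
proof -
  obtain k \<alpha> x where t: "0 \<le> t" and k: "1 \<le> k" and x: "x \<in> sa_mats st k" "nrm k k x \<le> 1"
    and p: "(\<lambda>i j. sandwich n k \<alpha> x i j - herm_part n y i j) \<in> pos n"
    and w: "\<And>w. quad_form n h w + adj_sq n k \<alpha> w \<le> t * vec_sq n w"
    using assms(2) unfolding feasible_def by blast
  obtain k' \<alpha>' x' where t': "0 \<le> t'" and k': "1 \<le> k'" and x': "x' \<in> sa_mats st k'" "nrm k' k' x' \<le> 1"
    and p': "(\<lambda>i j. sandwich n k' \<alpha>' x' i j - herm_part n y' i j) \<in> pos n"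
    and w': "\<And>w. quad_form n h' w + adj_sq n k' \<alpha>' w \<le> t' * vec_sq n w"
    using assms(3) unfolding feasible_def by blast
  \<comment> \<open>The row \<open>(\<alpha> \<alpha>')\<close>. The direct sum it compresses is
    still a contraction, by the maximum formula for norms.\<close>
  define \<beta> where "\<beta> = (\<lambda>i p. if p < k then \<alpha> i p else \<alpha>' i (p - k))"
  have sandwich: "sandwich n (k + k') \<beta> (dsum k k x x') i j = sandwich n k \<alpha> x i j + sandwich n k' \<alpha>' x' i j" for i j
    unfolding sandwich_apply sum_lessThan_add \<beta>_def dsum_def by simp
  have adj_sq: "adj_sq n (k + k') \<beta> w = adj_sq n k \<alpha> w + adj_sq n k' \<alpha>' w" for w
    unfolding adj_sq_def sum_lessThan_add \<beta>_def by simp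
  have quad_form: "quad_form n (h + h') w = quad_form n h w + quad_form n h' w" for w
    unfolding quad_form_def by (simp add: sum.distrib[symmetric] algebra_simps)
  show ?thesis
  proof (rule feasibleI)
    show "0 \<le> t + t'" "1 \<le> k + k'" using t t' k by auto
    show "dsum k k x x' \<in> sa_mats st (k + k')" using x x' sa_mats_dsum by blast
    show "nrm (k + k') (k + k') (dsum k k x x') \<le> 1"
      using nrm_dsum[OF k k k' k' sa_mats_mats[OF x(1)] sa_mats_mats[OF x'(1)]] x(2) x'(2) by simp
    show "(\<lambda>i j. sandwich n (k + k') \<beta> (dsum k k x x') i j - herm_part n (y + y') i j) \<in> pos n"
      using pos_add[OF n p p'] unfolding sandwich herm_part_add by (simp add: algebra_simps)
    show "quad_form n (h + h') w + adj_sq n (k + k') \<beta> w \<le> (t + t') * vec_sq n w" for w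
      using w[of w] w'[of w] unfolding quad_form adj_sq by (simp add: algebra_simps)
  qed
qed

lemma feasible_scale:
  assumes n: "1 \<le> n" and c: "0 \<le> c" and "feasible n h y t"
  shows "feasible n (\<lambda>i j. complex_of_real c * h i j) (\<lambda>i j. sc (complex_of_real c) (y i j)) (c * t)"
proof -
  obtain k \<alpha> x where t: "0 \<le> t" and k: "1 \<le> k" and x: "x \<in> sa_mats st k" "nrm k k x \<le> 1"
    and p: "(\<lambda>i j. sandwich n k \<alpha> x i j - herm_part n y i j) \<in> pos n"
    and w: "\<And>w. quad_form n h w + adj_sq n k \<alpha> w \<le> t * vec_sq n w"
    using assms(3) unfolding feasible_def by blast
  \<comment> \<open>The factor goes into \<open>\<alpha>\<close> as a square root, so
    \<open>x\<close> stays a contraction; \<open>c = 0\<close> is covered too.\<close>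
  define \<beta> where "\<beta> = (\<lambda>i p. complex_of_real (sqrt c) * \<alpha> i p)"
  have cc: "complex_of_real (sqrt c) * complex_of_real (sqrt c) = complex_of_real c"
    using c by (simp flip: of_real_mult)
  have sandwich: "sandwich n k \<beta> x i j = sc (complex_of_real c) (sandwich n k \<alpha> x i j)" for i j
    unfolding sandwich_apply \<beta>_def
    by (auto simp: V.scale_sum_right cc[symmetric] ac_simps intro!: sum.cong)
  have \<beta>: "(\<Sum>i<n. cnj (\<beta> i p) * w i) = complex_of_real (sqrt c) * (\<Sum>i<n. cnj (\<alpha> i p) * w i)" for p w
    unfolding \<beta>_def by (simp add: sum_distrib_left mult.assoc)
  have adj_sq: "adj_sq n k \<beta> w = c * adj_sq n k \<alpha> w" for w
    unfolding adj_sq_def \<beta> sum_distrib_left[of c] using c by (simp add: norm_mult power_mult_distrib)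
  have quad_form: "quad_form n (\<lambda>i j. complex_of_real c * h i j) w = c * quad_form n h w" for w
  proof -
    have "Re (cnj (w i) * (complex_of_real c * h i j) * w j) = c * Re (cnj (w i) * h i j * w j)" for i j
      by (simp add: algebra_simps)
    then show ?thesis unfolding quad_form_def sum_distrib_left by simp
  qed
  show ?thesis
  proof (rule feasibleI)
    show "0 \<le> c * t" using t c by simp
    show "(\<lambda>i j. sandwich n k \<beta> x i j - herm_part n (\<lambda>i j. sc (complex_of_real c) (y i j)) i j) \<in> pos n"
      using pos_scale[OF n p c] unfolding sandwich herm_part_scale by (simp add: V.scale_right_diff_distrib)
    show "quad_form n (\<lambda>i j. complex_of_real c * h i j) w + adj_sq n k \<beta> w \<le> c * t * vec_sq n w" for w
      using mult_left_mono[OF w[of w] c] unfolding quad_form adj_sq by (simp add: algebra_simps)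
  qed (fact k x)+
qed

text \<open>A crude bound through the entries, good enough to show that some \<open>t\<close> is
  feasible.\<close>

lemma norm_quad_form_le: "quad_form n h w \<le> (\<Sum>i<n. \<Sum>j<n. cmod (h i j)) * vec_sq n w"
proof -
  have "Re (cnj (w i) * h i j * w j) \<le> cmod (h i j) * vec_sq n w" if ij: "i < n" "j < n" for i j
  proof -
    have le: "(cmod (w l))\<^sup>2 \<le> vec_sq n w" if "l < n" for l
      unfolding vec_sq_def by (rule member_le_sum) (use that in auto)
    have "2 * (cmod (w i) * cmod (w j)) \<le> (cmod (w i))\<^sup>2 + (cmod (w j))\<^sup>2"
      using sum_squares_bound[of "cmod (w i)" "cmod (w j)"] by simp
    then have 1: "cmod (w i) * cmod (w j) \<le> vec_sq n w" using le[OF ij(1)] le[OF ij(2)] by linarith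
    have "Re (cnj (w i) * h i j * w j) \<le> cmod (cnj (w i) * h i j * w j)" by (rule complex_Re_le_cmod)
    also have "\<dots> = cmod (h i j) * (cmod (w i) * cmod (w j))" by (simp add: norm_mult)
    also have "\<dots> \<le> cmod (h i j) * vec_sq n w" using 1 by (rule mult_left_mono) simp
    finally show ?thesis .
  qed
  then show ?thesis unfolding quad_form_def sum_distrib_right by (intro sum_mono) auto
qed

lemma sandwich_diag: "sandwich n n (\<lambda>i p. if i = p then c else 0) x i j =
    (if i < n \<and> j < n then sc (c * cnj c) (x i j) else 0)"
proof (cases "i < n \<and> j < n")
  case True
  have "sandwich n n (\<lambda>i p. if i = p then c else 0) x i j =
      (\<Sum>p<n. \<Sum>q<n. if q = j then (if p = i then sc (c * cnj c) (x p q) else 0) else 0)"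
    unfolding sandwich_apply using True by (simp only: if_True simp_thms) (intro sum.cong refl, auto)
  also have "\<dots> = sc (c * cnj c) (x i j)"
    using True by simp
  finally show ?thesis using True by simp
qed (auto simp: sandwich_apply)

lemma feasible_exists:
  assumes n: "1 \<le> n"
  shows "\<exists>t. feasible n h y t"
proof -
  define y0 where "y0 = herm_part n y"
  have y0: "y0 \<in> sa_mats st n" unfolding y0_def by (rule herm_part_sa_mats)
  \<comment> \<open>The summand 1 keeps \<open>N\<close> positive when \<open>y0 = 0\<close>;
    \<open>y0\<close> is the compression of the contraction \<open>y0 / N\<close> by
    \<open>sqrt N\<close> times the identity.\<close>
  define N where "N = nrm n n y0 + 1"
  have N: "0 < N" using nrm_nonneg[OF n n sa_mats_mats[OF y0]] unfolding N_def by simp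
  define x where "x = mscale sc (complex_of_real (1/N)) y0"
  define \<alpha> where "\<alpha> = (\<lambda>i p::nat. if i = p then complex_of_real (sqrt N) else (0::complex))"
  have x: "x \<in> sa_mats st n" using y0 unfolding x_def mscale_def sa_mats_iff by (auto simp: st_scale)
  have "nrm n n x = nrm n n y0 / N"
    unfolding x_def nrm_scale[OF n n sa_mats_mats[OF y0]] using N by (simp add: norm_divide)
  then have nx: "nrm n n x \<le> 1" using N unfolding N_def by simp
  have sandwich: "sandwich n n \<alpha> x i j = y0 i j" for i j
    using y0 N unfolding \<alpha>_def sandwich_diag x_def mscale_def sa_mats_iff by (auto simp flip: of_real_mult)
  have adj_sq: "adj_sq n n \<alpha> w = N * vec_sq n w" for w
  proof -
    have "(\<Sum>i<n. cnj (\<alpha> i p) * w i) = complex_of_real (sqrt N) * w p" if "p < n" for p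
    proof -
      have "(\<Sum>i<n. cnj (\<alpha> i p) * w i) = (\<Sum>i<n. if i = p then complex_of_real (sqrt N) * w i else 0)"
        unfolding \<alpha>_def by (rule sum.cong) auto
      then show ?thesis using that by simp
    qed
    then show ?thesis unfolding adj_sq_def vec_sq_def using N
      by (simp add: norm_mult power_mult_distrib sum_distrib_left)
  qed
  have "feasible n h y ((\<Sum>i<n. \<Sum>j<n. cmod (h i j)) + N)"
  proof (rule feasibleI[OF _ n x nx])
    show "0 \<le> (\<Sum>i<n. \<Sum>j<n. cmod (h i j)) + N" using N by (simp add: sum_nonneg)
    show "(\<lambda>i j. sandwich n n \<alpha> x i j - herm_part n y i j) \<in> pos n"
      unfolding sandwich y0_def using pos_zero[OF n] by simp
    show "quad_form n h w + adj_sq n n \<alpha> w \<le> ((\<Sum>i<n. \<Sum>j<n. cmod (h i j)) + N) * vec_sq n w" for w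
      using norm_quad_form_le[of n h w] unfolding adj_sq by (simp add: algebra_simps)
  qed
  then show ?thesis by blast
qed

section \<open>The gauge as a sublinear functional, and what it says about norm and cone\<close>

definition gauge :: "nat \<Rightarrow> (nat \<Rightarrow> nat \<Rightarrow> complex) \<times> (nat \<Rightarrow> nat \<Rightarrow> 'v) \<Rightarrow> real" where
  "gauge n z = Inf {t. feasible n (fst z) (snd z) t}"

definition pscale :: "real \<Rightarrow> (nat \<Rightarrow> nat \<Rightarrow> complex) \<times> (nat \<Rightarrow> nat \<Rightarrow> 'v) \<Rightarrow> (nat \<Rightarrow> nat \<Rightarrow> complex) \<times> (nat \<Rightarrow> nat \<Rightarrow> 'v)" where
  "pscale c z = (\<lambda>i j. complex_of_real c * fst z i j, \<lambda>i j. sc (complex_of_real c) (snd z i j))"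

lemma pscale_vs: "vector_space pscale"
  by unfold_locales
     (auto simp: pscale_def prod_eq_iff fun_eq_iff V.scale_right_distrib V.scale_left_distrib algebra_simps)

lemma feasible_bdd: "bdd_below {t. feasible n h y t}"
  by (rule bdd_belowI[of _ 0]) (auto simp: feasible_def)

lemma gauge_le: "feasible n h y t \<Longrightarrow> gauge n (h, y) \<le> t"
  unfolding gauge_def by (auto intro!: cInf_lower feasible_bdd)

lemma gauge_less: "1 \<le> n \<Longrightarrow> gauge n (h, y) < t \<Longrightarrow> \<exists>u<t. feasible n h y u"
  unfolding gauge_def using feasible_exists[of n h y] by (auto simp: cInf_less_iff feasible_bdd)

lemma gauge_nonneg: "1 \<le> n \<Longrightarrow> 0 \<le> gauge n z"
  unfolding gauge_def using feasible_exists[of n "fst z" "snd z"]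
  by (intro cInf_greatest) (auto simp: feasible_def)

lemma gauge_sublinear:
  assumes n: "1 \<le> n"
  shows "sublinear pscale (gauge n)"
  unfolding sublinear_def
proof (intro conjI allI impI)
  fix z z' :: "(nat \<Rightarrow> nat \<Rightarrow> complex) \<times> (nat \<Rightarrow> nat \<Rightarrow> 'v)"
  obtain h y h' y' where z: "z = (h, y)" "z' = (h', y')" by (cases z, cases z')
  show "gauge n (z + z') \<le> gauge n z + gauge n z'"
  proof (rule field_le_epsilon)
    fix e :: real assume "0 < e"
    then obtain t t' where t: "t < gauge n z + e/2" "feasible n h y t" "t' < gauge n z' + e/2" "feasible n h' y' t'"
      using gauge_less[OF n, of h y "gauge n z + e/2"] gauge_less[OF n, of h' y' "gauge n z' + e/2"]
      unfolding z by auto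
    have "gauge n (z + z') \<le> t + t'"
      unfolding z using gauge_le[OF feasible_add[OF n t(2) t(4)]] by simp
    then show "gauge n (z + z') \<le> gauge n z + gauge n z' + e" using t by linarith
  qed
next
  fix c :: real and z :: "(nat \<Rightarrow> nat \<Rightarrow> complex) \<times> (nat \<Rightarrow> nat \<Rightarrow> 'v)" assume c: "0 \<le> c"
  obtain h y where z: "z = (h, y)" by (cases z)
  show "gauge n (pscale c z) \<le> c * gauge n z"
  proof (rule field_le_epsilon)
    fix e :: real assume e: "0 < e"
    \<comment> \<open>Dividing by \<open>c + 1\<close> and not by \<open>c\<close> covers
      \<open>c = 0\<close>.\<close>
    obtain t where t: "t < gauge n z + e / (c + 1)" "feasible n h y t"
      using gauge_less[OF n, of h y "gauge n z + e/(c+1)"] c e unfolding z by auto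
    have "gauge n (pscale c z) \<le> c * t"
      unfolding z pscale_def using gauge_le[OF feasible_scale[OF n c t(2)]] by simp
    also have "\<dots> \<le> c * (gauge n z + e / (c + 1))" using t c by (intro mult_left_mono) auto
    also have "\<dots> \<le> c * gauge n z + e" using c e by (simp add: field_simps)
    finally show "gauge n (pscale c z) \<le> c * gauge n z + e" .
  qed
qed

text \<open>The hypothesis bounds the norm of \<open>\<alpha>^*\<close> by \<open>sqrt t\<close>,
  hence also that of \<open>\<alpha>\<close>, and the operator space axiom for scalar multiplication
  yields the product of both.\<close>

lemma nrm_sandwich_le:
  assumes n: "1 \<le> n" and k: "1 \<le> k" and x: "x \<in> sa_mats st k" "nrm k k x \<le> 1" and t: "0 \<le> t"
    and w: "\<And>w. adj_sq n k \<alpha> w \<le> t * vec_sq n w"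
  shows "nrm n n (sandwich n k \<alpha> x) \<le> t"
proof -
  have a: "(\<Sum>p<k. (cmod (\<Sum>i<n. cnj (\<alpha> i p) * w i))\<^sup>2) \<le> t * (\<Sum>i<n. (cmod (w i))\<^sup>2)" for w
    using w[of w] unfolding adj_sq_def vec_sq_def .
  have 1: "cmat_norm n k \<alpha> \<le> sqrt t" "0 \<le> cmat_norm n k \<alpha>"
    using cmat_norm_bounds[where c="sqrt t" and X=\<alpha> and k=n and n=k] adjoint_bound[OF t a] t by auto
  have 2: "cmat_norm k n (cstar \<alpha>) \<le> sqrt t" "0 \<le> cmat_norm k n (cstar \<alpha>)"
    using cmat_norm_bounds[where c="sqrt t" and X="cstar \<alpha>" and k=k and n=n] a t unfolding cstar_def by auto
  have "nrm n n (sandwich n k \<alpha> x) \<le> cmat_norm n k \<alpha> * nrm k k x * cmat_norm k n (cstar \<alpha>)"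
    unfolding sandwich_def using nrm_smul3[OF k k n n sa_mats_mats[OF x(1)]] .
  also have "\<dots> \<le> sqrt t * 1 * sqrt t"
    using 1 2 x nrm_nonneg[OF k k sa_mats_mats[OF x(1)]] t by (intro mult_mono) auto
  finally show ?thesis using t by simp
qed

text \<open>For \<open>h = 0\<close> the compression \<open>\<alpha> x \<alpha>^*\<close> is itself
  the majorant sought.\<close>

lemma feasible_zero_left:
  assumes n: "1 \<le> n" and y: "y \<in> sa_mats st n" and f: "feasible n 0 y t"
  obtains z where "z \<in> sa_mats st n" "nrm n n z \<le> t" "(\<lambda>i j. z i j - y i j) \<in> pos n"
proof -
  obtain k \<alpha> x where t: "0 \<le> t" and k: "1 \<le> k" and x: "x \<in> sa_mats st k" "nrm k k x \<le> 1"
    and p: "(\<lambda>i j. sandwich n k \<alpha> x i j - herm_part n y i j) \<in> pos n"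
    and w: "\<And>w. quad_form n 0 w + adj_sq n k \<alpha> w \<le> t * vec_sq n w"
    using f unfolding feasible_def by blast
  have "adj_sq n k \<alpha> w \<le> t * vec_sq n w" for w using w[of w] by (simp add: quad_form_def)
  then show ?thesis
    using that[of "sandwich n k \<alpha> x"] nrm_sandwich_le[OF n k x t] sandwich_sa[OF x(1)] p herm_part_sa[OF y] by simp
qed

text \<open>With majorants \<open>z\<close> of \<open>A\<close> and \<open>z'\<close> of
  \<open>- A\<close> whose norms exceed the gauges by less than \<open>e\<close>, normality applies
  to \<open>- z'\<close> \<le> \<open>A\<close> \<le> \<open>z\<close>.\<close>

lemma nrm_le_gauge:
  assumes n: "1 \<le> n" and A: "A \<in> sa_mats st n"
  shows "nrm n n A \<le> max (gauge n (0, A)) (gauge n (0, - A))"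
proof (rule field_le_epsilon)
  fix e :: real assume e: "0 < e"
  have A': "- A \<in> sa_mats st n" using A unfolding sa_mats_iff by (auto simp: st_uminus)
  obtain t where t: "t < gauge n (0, A) + e" "feasible n 0 A t"
    using gauge_less[OF n, of 0 A] e by (metis less_add_same_cancel1)
  obtain t' where t': "t' < gauge n (0, - A) + e" "feasible n 0 (- A) t'"
    using gauge_less[OF n, of 0 "- A"] e by (metis less_add_same_cancel1)
  obtain z where z: "z \<in> sa_mats st n" "nrm n n z \<le> t" "(\<lambda>i j. z i j - A i j) \<in> pos n"
    using feasible_zero_left[OF n A t(2)] by blast
  obtain z' where z': "z' \<in> sa_mats st n" "nrm n n z' \<le> t'" "(\<lambda>i j. z' i j - (- A) i j) \<in> pos n"
    using feasible_zero_left[OF n A' t'(2)] by blast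
  have z'': "mscale sc (- 1) z' \<in> sa_mats st n"
    using z'(1) unfolding sa_mats_iff mscale_def by (auto simp: st_uminus)
  have "nrm n n A \<le> max (nrm n n (mscale sc (- 1) z')) (nrm n n z)"
    by (rule nrm_normal[OF n z'' A z(1) _ z(3)]) (use z'(3) in \<open>simp add: mscale_def add.commute\<close>)
  also have "\<dots> \<le> max t' t"
    using z(2) z'(2) unfolding nrm_scale[OF n n sa_mats_mats[OF z'(1)]] by auto
  finally show "nrm n n A \<le> max (gauge n (0, A)) (gauge n (0, - A)) + e" using t(1) t'(1) by auto
qed

text \<open>There are majorants \<open>z k\<close> of \<open>- A\<close> with norms tending to 0;
  the positive matrices \<open>z k + A\<close> converge to \<open>A\<close>, and the cone is
  closed.\<close>

lemma gauge_zero_pos: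
  assumes n: "1 \<le> n" and A: "A \<in> sa_mats st n" and g: "gauge n (0, - A) = 0"
  shows "A \<in> pos n"
proof -
  have A': "- A \<in> sa_mats st n" using A unfolding sa_mats_iff by (auto simp: st_uminus)
  have "\<exists>z. z \<in> mats n n \<and> nrm n n z \<le> inverse (real (Suc k)) \<and> (\<lambda>i j. z i j + A i j) \<in> pos n" for k
  proof -
    obtain t where t: "t < inverse (real (Suc k))" "feasible n 0 (- A) t"
      using gauge_less[OF n, of 0 "- A" "inverse (real (Suc k))"] g by auto
    obtain z where "z \<in> sa_mats st n" "nrm n n z \<le> t" "(\<lambda>i j. z i j - (- A) i j) \<in> pos n"
      using feasible_zero_left[OF n A' t(2)] by blast
    then show ?thesis using t(1) sa_mats_mats by (intro exI[of _ z]) auto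
  qed
  then obtain z where z: "\<And>k. z k \<in> mats n n" "\<And>k. nrm n n (z k) \<le> inverse (real (Suc k))"
    "\<And>k. (\<lambda>i j. z k i j + A i j) \<in> pos n" by metis
  have "(\<lambda>k. nrm n n (z k)) \<longlonglongrightarrow> 0"
    by (rule tendsto_sandwich[OF _ _ tendsto_const LIMSEQ_inverse_real_of_nat])
       (use z(2) nrm_nonneg[OF n n z(1)] in auto)
  then show ?thesis by (intro pos_closed[OF n z(3) A]) simp
qed

end

lemma sum_fun_apply: "(\<Sum>i\<in>A. f i) x = (\<Sum>i\<in>A. f i x)"
  by (induction A rule: infinite_finite_induct) simp_all

lemma additive_sum:
  fixes F :: "'a::ab_group_add \<Rightarrow> 'b::ab_group_add"
  assumes "\<And>x y. F (x + y) = F x + F y"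
  shows "F (\<Sum>i\<in>I. f i) = (\<Sum>i\<in>I. F (f i))"
  by (rule additive.sum[OF additive.intro]) (rule assms)

section \<open>Completely contractive, completely positive maps into matrix algebras\<close>

definition unit_vec :: "nat \<Rightarrow> nat \<Rightarrow> complex" where
  "unit_vec i t = (if t = i then 1 else 0)"

text \<open>\<open>B v a b\<close> stands for \<open>F (a v b\<^sup>*)\<close> and \<open>P a b\<close> for \<open>p (a b\<^sup>*)\<close>, where \<open>F\<close> is a functional on
  matrices over V dominated by the functional \<open>p\<close> on scalar matrices.\<close>
locale form_pair = normal_space sc st nrm pos + semi_inner P
  for sc :: "complex \<Rightarrow> 'v::ab_group_add \<Rightarrow> 'v" and st nrm pos P +
  fixes B :: "'v \<Rightarrow> (nat \<Rightarrow> complex) \<Rightarrow> (nat \<Rightarrow> complex) \<Rightarrow> complex"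
  assumes B_lin: "B (sc c v + w) a b = c * B v a b + B w a b"
    and B_add: "B v (\<lambda>t. a t + a' t) b = B v a b + B v a' b"
    and B_scale: "B v (\<lambda>t. c * a t) b = c * B v a b"
    and B_st: "B (st v) b a = cnj (B v a b)"
    and B_bound: "1 \<le> k \<Longrightarrow> x \<in> sa_mats st k \<Longrightarrow> nrm k k x \<le> 1 \<Longrightarrow>
      Re (\<Sum>p<k. \<Sum>q<k. B (x p q) (f p) (f q)) \<le> (\<Sum>p<k. Re (P (f p) (f p)))"
    and B_pos: "1 \<le> k \<Longrightarrow> x \<in> pos k \<Longrightarrow> 0 \<le> Re (\<Sum>p<k. \<Sum>q<k. B (x p q) (f p) (f q))"

context normal_space
begin

section \<open>From a functional below the gauge to a pair of forms\<close>

definition cscale :: "complex \<Rightarrow> (nat \<Rightarrow> nat \<Rightarrow> complex) \<times> (nat \<Rightarrow> nat \<Rightarrow> 'v) \<Rightarrow> (nat \<Rightarrow> nat \<Rightarrow> complex) \<times> (nat \<Rightarrow> nat \<Rightarrow> 'v)" where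
  "cscale c z = (\<lambda>i j. c * fst z i j, \<lambda>i j. sc c (snd z i j))"

lemma cscale_vs: "vector_space cscale"
  by unfold_locales
     (auto simp: cscale_def prod_eq_iff fun_eq_iff V.scale_right_distrib V.scale_left_distrib algebra_simps)

lemma quad_form_uminus: "quad_form n (- h) w = - quad_form n h w"
  unfolding quad_form_def by (simp add: sum_negf[symmetric])

lemma quad_form_cstar: "quad_form n (cstar h) w = quad_form n h w"
  unfolding quad_form_def
proof (subst sum.swap, intro sum.cong refl)
  fix i j
  have "cnj (cnj (w j) * cstar h j i * w i) = cnj (w i) * h i j * w j"
    unfolding cstar_def by simp
  then show "Re (cnj (w j) * cstar h j i * w i) = Re (cnj (w i) * h i j * w j)"
    by (metis cnj.sel(1))
qed

text \<open>The self-adjoint part of such a difference vanishes. Applied to a pair and to its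
  adjoint, this makes every real functional below the gauge invariant under adjoints.\<close>

lemma feasible_diff_star:
  assumes n: "1 \<le> n"
  shows "feasible n (h - cstar h) (y - mstar st y) 0"
proof (rule feasible_trivial[OF n])
  have "herm_part n (y - mstar st y) = (\<lambda>i j. 0)"
    unfolding herm_part_def mstar_def by (auto simp: fun_eq_iff st_diff)
  then show "(\<lambda>i j. - herm_part n (y - mstar st y) i j) \<in> pos n" using pos_zero[OF n] by simp
  have "quad_form n (h - cstar h) w = quad_form n h w - quad_form n (cstar h) w" for w
    unfolding quad_form_def by (simp add: sum_subtractf[symmetric] algebra_simps)
  then show "quad_form n (h - cstar h) w \<le> 0 * vec_sq n w" for w using quad_form_cstar[of n h w] by simp
qed simp

definition outer :: "(nat \<Rightarrow> complex) \<Rightarrow> (nat \<Rightarrow> complex) \<Rightarrow> nat \<Rightarrow> nat \<Rightarrow> complex" where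
  "outer a b i j = a i * cnj (b j)"

text \<open>Unlike \<open>outer\<close> it is cut to the index range, to match
  \<open>sandwich\<close>; scalar matrices enter the gauge only through \<open>quad_form\<close>,
  which reads the entries in the range.\<close>

definition vouter :: "nat \<Rightarrow> 'v \<Rightarrow> (nat \<Rightarrow> complex) \<Rightarrow> (nat \<Rightarrow> complex) \<Rightarrow> nat \<Rightarrow> nat \<Rightarrow> 'v" where
  "vouter n v a b i j = (if i < n \<and> j < n then sc (a i * cnj (b j)) v else 0)"

lemma sandwich_eq_sum_vouter: "sandwich n k (\<lambda>i p. f p i) x = (\<Sum>p<k. \<Sum>q<k. vouter n (x p q) (f p) (f q))"
  by (auto simp: fun_eq_iff sandwich_apply sum_fun_apply vouter_def)

text \<open>The vectors \<open>f p\<close> are the columns of \<open>\<alpha>\<close>, so the matrix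
  on the left is \<open>\<alpha> \<alpha>^*\<close>.\<close>

lemma quad_form_sum_outer: "quad_form n (\<Sum>p<k. outer (f p) (f p)) w = adj_sq n k (\<lambda>i p. f p i) w"
proof -
  have "complex_of_real (adj_sq n k (\<lambda>i p. f p i) w) = (\<Sum>p<k. \<Sum>i<n. \<Sum>j<n. cnj (w i) * (f p i * cnj (f p j)) * w j)"
    unfolding adj_sq_def of_real_sum complex_norm_square
  proof (intro sum.cong refl)
    fix p
    have "(\<Sum>i<n. cnj (f p i) * w i) * cnj (\<Sum>i<n. cnj (f p i) * w i)
      = (\<Sum>i<n. f p i * cnj (w i)) * (\<Sum>j<n. cnj (f p j) * w j)" by (simp add: mult.commute)
    also have "\<dots> = (\<Sum>i<n. \<Sum>j<n. cnj (w i) * (f p i * cnj (f p j)) * w j)"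
      unfolding sum_product by (simp add: ac_simps)
    finally show "(\<Sum>i<n. cnj (f p i) * w i) * cnj (\<Sum>i<n. cnj (f p i) * w i) = \<dots>" .
  qed
  also have "\<dots> = (\<Sum>i<n. \<Sum>p<k. \<Sum>j<n. cnj (w i) * (f p i * cnj (f p j)) * w j)" by (rule sum.swap)
  also have "\<dots> = (\<Sum>i<n. \<Sum>j<n. \<Sum>p<k. cnj (w i) * (f p i * cnj (f p j)) * w j)"
    by (intro sum.cong refl sum.swap)
  also have "\<dots> = (\<Sum>i<n. \<Sum>j<n. cnj (w i) * (\<Sum>p<k. outer (f p) (f p)) i j * w j)"
    by (simp add: sum_fun_apply outer_def sum_distrib_left sum_distrib_right)
  finally have "Re (complex_of_real (adj_sq n k (\<lambda>i p. f p i) w)) =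
      Re (\<Sum>i<n. \<Sum>j<n. cnj (w i) * (\<Sum>p<k. outer (f p) (f p)) i j * w j)" by (rule arg_cong)
  then show ?thesis unfolding quad_form_def Re_sum Re_complex_of_real by (rule sym)
qed

text \<open>\<open>P\<close> and \<open>B\<close> are the complexified Hahn-Banach functional at
  \<open>(0, A)\<close>, evaluated on rank-one matrices. Each inequality required of them comes from
  exhibiting a feasible pair.\<close>

lemma form_pair_exists:
  assumes n: "1 \<le> n" and A: "A \<in> sa_mats st n"
  obtains P B where "form_pair sc st nrm pos P B"
    "(\<Sum>i<n. Re (P (unit_vec i) (unit_vec i))) \<le> 1"
    "Re (\<Sum>i<n. \<Sum>j<n. B (A i j) (unit_vec i) (unit_vec j)) = gauge n (0, A)"
proof -
  obtain f where f_add: "\<And>x y. f (x + y) = f x + f y" and f_scale: "\<And>c x. f (pscale c x) = c * f x"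
    and f_le: "\<And>x. f x \<le> gauge n x" and fA: "f (0, A) = gauge n (0, A)"
    using hahn_banach_sublinear[OF pscale_vs gauge_sublinear[OF n]] by metis
  have f_cscale: "f (cscale (complex_of_real r) x) = r * f x" for r x
    using f_scale[of r x] unfolding pscale_def cscale_def .
  define F where "F z = Complex (f z) (- f (cscale \<i> z))" for z
  have F_add: "F (x + y) = F x + F y" for x y
    unfolding F_def by (rule complexification_linear(1)[OF cscale_vs f_add f_cscale])
  have F_scale: "F (cscale c x) = c * F x" for c x
    unfolding F_def by (rule complexification_linear(2)[OF cscale_vs f_add f_cscale])
  have Re_F: "Re (F z) = f z" for z unfolding F_def by simp
  have f_zero: "f 0 = 0" using f_add[of 0 0] by simp
  have f_minus: "f (- z) = - f z" for z using f_add[of z "- z"] f_zero by simp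
  have f_diff: "f (y - z) = f y - f z" for y z using f_add[of y "- z"] f_minus by simp
  have star_le: "f (h, y) \<le> f (cstar h, mstar st y)" for h y
  proof -
    have "f ((h, y) - (cstar h, mstar st y)) \<le> 0"
      using f_le[of "(h, y) - (cstar h, mstar st y)"] gauge_le[OF feasible_diff_star[OF n, of h y]] by simp
    then show ?thesis unfolding f_diff by simp
  qed
  have star_star: "cstar (cstar h) = h" "mstar st (mstar st y) = y" for h y
    unfolding cstar_def mstar_def by simp_all
  have f_star: "f (cstar h, mstar st y) = f (h, y)" for h y
    using star_le[of h y] star_le[of "cstar h" "mstar st y"] unfolding star_star by simp
  have F_star: "F (cstar h, mstar st y) = cnj (F (h, y))" for h y
  proof -
    \<comment> \<open>So far only the real part \<open>f\<close> is known to be invariant. The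
      adjoint turns \<open>\<i>\<close> into \<open>- \<i>\<close>, which conjugates the imaginary
      part.\<close>
    have "cscale \<i> (cstar h, mstar st y) =
        (cstar (fst (cscale (- \<i>) (h, y))), mstar st (snd (cscale (- \<i>) (h, y))))"
      unfolding cscale_def cstar_def mstar_def by (simp add: fun_eq_iff st_scale st_uminus)
    then have "f (cscale \<i> (cstar h, mstar st y)) = f (cscale (- \<i>) (h, y))"
      by (simp add: f_star)
    also have "cscale (- \<i>) (h, y) = - cscale \<i> (h, y)"
      unfolding cscale_def by (simp add: fun_eq_iff)
    finally show ?thesis unfolding F_def f_minus f_star by (simp add: complex_eq_iff)
  qed
  define P where "P a b = F (outer a b, 0)" for a b
  define B where "B v a b = F (0, vouter n v a b)" for v a b
  have sumB: "(\<Sum>p<k. \<Sum>q<k. B (x p q) (g p) (g q)) = F (0, sandwich n k (\<lambda>i p. g p i) x)" for k x g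
  proof -
    have "(0, sandwich n k (\<lambda>i p. g p i) x) = (\<Sum>p<k. \<Sum>q<k. (0 :: nat \<Rightarrow> nat \<Rightarrow> complex, vouter n (x p q) (g p) (g q)))"
      unfolding sandwich_eq_sum_vouter by (simp add: prod_eq_iff fst_sum snd_sum)
    then show ?thesis unfolding B_def by (simp add: additive_sum[of F, OF F_add])
  qed
  have sumP: "(\<Sum>p<k. P (g p) (g p)) = F (\<Sum>p<k. outer (g p) (g p), 0)" for k :: nat and g
  proof -
    have "(\<Sum>p<k. outer (g p) (g p), 0 :: nat \<Rightarrow> nat \<Rightarrow> 'v) = (\<Sum>p<k. (outer (g p) (g p), 0))"
      by (simp add: prod_eq_iff fst_sum snd_sum)
    then show ?thesis unfolding P_def by (simp add: additive_sum[of F, OF F_add])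
  qed
  have bound: "Re (\<Sum>p<k. \<Sum>q<k. B (x p q) (g p) (g q)) \<le> (\<Sum>p<k. Re (P (g p) (g p)))"
    if k: "1 \<le> k" and x: "x \<in> sa_mats st k" "nrm k k x \<le> 1" for k x g
  proof -
    let ?\<alpha> = "\<lambda>i p. g p i" and ?h = "\<Sum>p<k. outer (g p) (g p)"
    have "feasible n (- ?h) (sandwich n k ?\<alpha> x) 0"
    proof (rule feasibleI[OF _ k x])
      show "(\<lambda>i j. sandwich n k ?\<alpha> x i j - herm_part n (sandwich n k ?\<alpha> x) i j) \<in> pos n"
        using herm_part_sa[OF sandwich_sa[OF x(1)]] pos_zero[OF n] by simp
      show "quad_form n (- ?h) w + adj_sq n k ?\<alpha> w \<le> 0 * vec_sq n w" for w
        unfolding quad_form_uminus quad_form_sum_outer by simp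
    qed simp
    then have "f (- ?h, sandwich n k ?\<alpha> x) \<le> 0" using gauge_le f_le order_trans by blast
    moreover have "(- ?h, sandwich n k ?\<alpha> x) = (0, sandwich n k ?\<alpha> x) - (?h, 0)" by simp
    ultimately have "f ((0, sandwich n k ?\<alpha> x) - (?h, 0)) \<le> 0" by (simp only:)
    then have "f (0, sandwich n k ?\<alpha> x) \<le> f (?h, 0)" unfolding f_diff by linarith
    then show ?thesis unfolding sumB Re_sum[symmetric] sumP Re_F .
  qed
  have B_pos: "0 \<le> Re (\<Sum>p<k. \<Sum>q<k. B (x p q) (g p) (g q))" if k: "1 \<le> k" and x: "x \<in> pos k" for k x g
  proof -
    let ?s = "sandwich n k (\<lambda>i p. g p i) x"
    have s: "?s \<in> pos n" unfolding sandwich_def by (rule pos_conj[OF n k x])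
    have "- ?s \<in> sa_mats st n" using pos_sa[OF n s] unfolding sa_mats_iff by (auto simp: st_uminus)
    then have "feasible n 0 (- ?s) 0" using s by (intro feasible_trivial[OF n]) (simp_all add: herm_part_sa quad_form_def)
    then have "f (0, - ?s) \<le> 0" using gauge_le f_le order_trans by blast
    moreover have "(0 :: nat \<Rightarrow> nat \<Rightarrow> complex, - ?s) = - (0, ?s)" by simp
    ultimately have "f (- (0, ?s)) \<le> 0" by (simp only:)
    then have "0 \<le> f (0, ?s)" unfolding f_minus by linarith
    then show ?thesis unfolding sumB Re_F .
  qed
  have B0: "vouter n 0 a b = 0" for a b unfolding vouter_def by (auto simp: fun_eq_iff)
  have fp: "form_pair sc st nrm pos P B"
  proof unfold_locales
    show "P (\<lambda>t. a t + b t) z = P a z + P b z" for a b z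
      unfolding P_def F_add[symmetric]
      by (rule arg_cong[of _ _ F]) (auto simp: outer_def prod_eq_iff fun_eq_iff distrib_right)
    show "P (\<lambda>t. c * a t) z = c * P a z" for c a z
      unfolding P_def F_scale[symmetric]
      by (rule arg_cong[of _ _ F]) (auto simp: outer_def cscale_def prod_eq_iff fun_eq_iff mult.assoc)
    show "P b a = cnj (P a b)" for a b
      unfolding P_def F_star[symmetric]
      by (rule arg_cong[of _ _ F]) (auto simp: outer_def cstar_def mstar_def prod_eq_iff fun_eq_iff mult.commute)
    \<comment> \<open>The bound for the 1 x 1 zero matrix and the single vector
      \<open>a\<close>.\<close>
    show "0 \<le> Re (P a a)" for a
      using bound[where k=1 and x="\<lambda>i j. 0" and g="\<lambda>_. a"] f_zero
      by (simp add: sa_mats_iff nrm_zero Re_F B_def B0 zero_prod_def)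
    show "B (sc c v + w) a b = c * B v a b + B w a b" for c v w a b
      unfolding B_def F_scale[symmetric] F_add[symmetric]
      by (rule arg_cong[of _ _ F])
         (auto simp: cscale_def vouter_def prod_eq_iff fun_eq_iff V.scale_right_distrib mult.commute)
    show "B v (\<lambda>t. a t + a' t) b = B v a b + B v a' b" for v a a' b
      unfolding B_def F_add[symmetric]
      by (rule arg_cong[of _ _ F])
         (auto simp: vouter_def prod_eq_iff fun_eq_iff V.scale_left_distrib distrib_right)
    show "B v (\<lambda>t. c * a t) b = c * B v a b" for v c a b
      unfolding B_def F_scale[symmetric]
      by (rule arg_cong[of _ _ F])
         (auto simp: vouter_def cscale_def prod_eq_iff fun_eq_iff mult.assoc)
    show "B (st v) b a = cnj (B v a b)" for v a b
      unfolding B_def F_star[symmetric]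
      by (rule arg_cong[of _ _ F])
         (auto simp: vouter_def cstar_def mstar_def prod_eq_iff fun_eq_iff st_scale mult.commute)
  qed (use bound B_pos in auto)
  \<comment> \<open>The rank-one matrices of the unit vectors add up to the identity, whose pair
    with 0 is feasible at 1.\<close>
  have "(\<Sum>i<n. Re (P (unit_vec i) (unit_vec i))) = f (\<Sum>i<n. outer (unit_vec i) (unit_vec i), 0)"
    unfolding Re_sum[symmetric] sumP Re_F ..
  also have "\<dots> \<le> 1"
  proof -
    have "(\<Sum>i<n. cnj (unit_vec p i) * w i) = w p" if "p < n" for p w
    proof -
      have "(\<Sum>i<n. cnj (unit_vec p i) * w i) = (\<Sum>i<n. if i = p then w i else 0)"
        unfolding unit_vec_def by (rule sum.cong) auto
      then show ?thesis using that by simp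
    qed
    then have "adj_sq n n (\<lambda>i p. unit_vec p i) w = vec_sq n w" for w
      unfolding adj_sq_def vec_sq_def by simp
    then have "feasible n (\<Sum>i<n. outer (unit_vec i) (unit_vec i)) 0 1"
      using herm_part_sa[of 0 n] pos_zero[OF n]
      by (intro feasible_trivial[OF n]) (simp_all add: quad_form_sum_outer sa_mats_iff)
    then show ?thesis using gauge_le f_le order_trans by blast
  qed
  finally have P1: "(\<Sum>i<n. Re (P (unit_vec i) (unit_vec i))) \<le> 1" .
  have "sandwich n n (\<lambda>i p. unit_vec p i) A = A"
    using A unfolding unit_vec_def sandwich_diag sa_mats_iff by (auto simp: fun_eq_iff sandwich_diag)
  then have "Re (\<Sum>i<n. \<Sum>j<n. B (A i j) (unit_vec i) (unit_vec j)) = gauge n (0, A)"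
    unfolding sumB Re_F using fA by simp
  then show ?thesis using that[OF fp P1] by blast
qed

section \<open>Reduction to self-adjoint matrices by off-diagonal blocks\<close>

lemma st_eq_0: "st v = 0 \<longleftrightarrow> v = 0"
  by (metis st_st st_zero)

text \<open>Selecting rows and columns without repetition is multiplication by 0-1 matrices of norm
  at most 1.\<close>

lemma nrm_select:
  assumes k: "1 \<le> k" and l: "1 \<le> l" and n: "1 \<le> n" and m: "1 \<le> m" and A: "A \<in> mats n m"
    and f: "inj_on f {..<k}" "f ` {..<k} \<subseteq> {..<n}" and g: "inj_on g {..<l}" "g ` {..<l} \<subseteq> {..<m}"
  shows "nrm k l (\<lambda>i j. if i < k \<and> j < l then A (f i) (g j) else 0) \<le> nrm n m A"
proof -
  define X where "X = (\<lambda>i p. if p = f i then 1 else (0::complex))"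
  define Y where "Y = (\<lambda>q j. if q = g j then 1 else (0::complex))"
  have sel: "(\<Sum>i<b. (cmod (\<Sum>j<a. (if j = h i then 1 else 0) * v j))\<^sup>2) \<le> 1\<^sup>2 * (\<Sum>j<a. (cmod (v j))\<^sup>2)"
    if h: "inj_on h {..<b}" "h ` {..<b} \<subseteq> {..<a}" for a b :: nat and h :: "nat \<Rightarrow> nat" and v
  proof -
    have "(\<Sum>j<a. (if j = h i then 1 else 0) * v j) = v (h i)" if "i < b" for i
    proof -
      have "(\<Sum>j<a. (if j = h i then 1 else 0) * v j) = (\<Sum>j<a. if j = h i then v j else 0)"
        by (rule sum.cong) auto
      then show ?thesis using that h(2) by auto
    qed
    then have "(\<Sum>i<b. (cmod (\<Sum>j<a. (if j = h i then 1 else 0) * v j))\<^sup>2) = (\<Sum>i<b. (cmod (v (h i)))\<^sup>2)"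
      by simp
    also have "\<dots> = (\<Sum>j\<in>h ` {..<b}. (cmod (v j))\<^sup>2)" using h(1) by (simp add: sum.reindex)
    also have "\<dots> \<le> (\<Sum>j<a. (cmod (v j))\<^sup>2)" by (rule sum_mono2) (use h(2) in auto)
    finally show ?thesis by simp
  qed
  have X: "cmat_norm k n X \<le> 1" "0 \<le> cmat_norm k n X"
    using cmat_norm_bounds[of 1, OF _ sel[OF f]] unfolding X_def by auto
  \<comment> \<open>Here it is the adjoint of \<open>Y\<close> that selects coordinates;
    \<open>adjoint_bound\<close> passes to \<open>Y\<close>.\<close>
  have "(\<Sum>j<l. (cmod (\<Sum>q<m. cnj (Y q j) * w q))\<^sup>2) \<le> 1 * (\<Sum>q<m. (cmod (w q))\<^sup>2)" for w
    using sel[OF g, of w] unfolding Y_def if_distrib[of cnj] complex_cnj_one complex_cnj_zero by simp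
  then have "(\<Sum>q<m. (cmod (\<Sum>j<l. Y q j * v j))\<^sup>2) \<le> 1\<^sup>2 * (\<Sum>j<l. (cmod (v j))\<^sup>2)" for v
    using adjoint_bound[where t=1 and n=m and \<alpha>=Y and k=l and v=v] by simp
  then have Y: "cmat_norm m l Y \<le> 1" "0 \<le> cmat_norm m l Y"
    using cmat_norm_bounds[where c=1 and n=l and X=Y and k=m] by auto
  have "smul3 sc k n m l X A Y i j = (if i < k \<and> j < l then A (f i) (g j) else 0)" for i j
  proof (cases "i < k \<and> j < l")
    case True
    have "smul3 sc k n m l X A Y i j = (\<Sum>p<n. \<Sum>q<m. if q = g j then (if p = f i then A p q else 0) else 0)"
      unfolding smul3_def X_def Y_def using True by (simp only: if_True simp_thms) (intro sum.cong refl, auto)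
    also have "\<dots> = (\<Sum>p<n. if p = f i then A p (g j) else 0)"
      using True g(2) by (auto intro!: sum.cong)
    also have "\<dots> = A (f i) (g j)" using True f(2) by auto
    finally show ?thesis using True by simp
  qed (auto simp: smul3_def)
  then have "nrm k l (\<lambda>i j. if i < k \<and> j < l then A (f i) (g j) else 0) = nrm k l (smul3 sc k n m l X A Y)"
    by (intro arg_cong[of _ _ "nrm k l"] ext) simp
  also have "\<dots> \<le> cmat_norm k n X * nrm n m A * cmat_norm m l Y" by (rule nrm_smul3[OF n m k l A])
  also have "\<dots> \<le> 1 * nrm n m A * 1"
    using X Y nrm_nonneg[OF n m A] by (intro mult_mono) auto
  finally show ?thesis by simp
qed

text \<open>The block matrix with rows \<open>0, x\<close> and \<open>x^*, 0\<close>. The second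
  dimension of \<open>x\<close> is implicit in where \<open>x\<close> vanishes.\<close>

definition hat :: "nat \<Rightarrow> (nat \<Rightarrow> nat \<Rightarrow> 'v) \<Rightarrow> nat \<Rightarrow> nat \<Rightarrow> 'v" where
  "hat k x i j = (if i < k \<and> k \<le> j then x i (j - k) else if k \<le> i \<and> j < k then st (x j (i - k)) else 0)"

lemma hat_sa: "x \<in> mats k l \<Longrightarrow> hat k x \<in> sa_mats st (k + l)"
proof -
  assume x: "x \<in> mats k l"
  have "j < k + l" if "k \<le> j" "x i (j - k) \<noteq> 0" for i j
  proof -
    have "j - k < l" using x that unfolding mats_def by blast
    then show ?thesis using that by linarith
  qed
  then show ?thesis unfolding sa_mats_iff hat_def by (auto simp: st_eq_0)
qed

text \<open>Exchanging the two blocks of columns turns \<open>hat k x\<close> into the direct sum of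
  \<open>x\<close> and its adjoint, which have the same norm; conversely \<open>x\<close> is a
  corner of \<open>hat k x\<close>.\<close>

lemma nrm_hat:
  assumes k: "1 \<le> k" and l: "1 \<le> l" and x: "x \<in> mats k l"
  shows "nrm (k + l) (k + l) (hat k x) = nrm k l x"
proof (rule antisym)
  have kl: "1 \<le> k + l" "1 \<le> l + k" using k by auto
  have xs: "mstar st x \<in> mats l k" using x unfolding mats_def mstar_def by (auto simp: st_eq_0)
  have D: "dsum k l x (mstar st x) \<in> mats (k + l) (l + k)"
  proof -
    have "i < k + l \<and> j < l + k" if "k \<le> i" "l \<le> j" "mstar st x (i - k) (j - l) \<noteq> 0" for i j
    proof -
      have "i - k < l \<and> j - l < k" using xs that unfolding mats_def by blast
      then show ?thesis using that by linarith
    qed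
    then show ?thesis using x unfolding mats_def dsum_def by (auto split: if_splits)
  qed
  \<comment> \<open>In the direct sum the columns of \<open>x^*\<close> come after the
    \<open>l\<close> columns of \<open>x\<close>; in \<open>hat k x\<close> they come first.\<close>
  define \<tau> where "\<tau> j = (if j < k then l + j else j - k)" for j
  have "hat k x = (\<lambda>i j. if i < k + l \<and> j < k + l then dsum k l x (mstar st x) (id i) (\<tau> j) else 0)"
  proof (intro ext)
    fix i j
    have "hat k x i j = 0" if "\<not> (i < k + l \<and> j < k + l)"
      using hat_sa[OF x] that unfolding sa_mats_iff by blast
    moreover have "hat k x i j = dsum k l x (mstar st x) i (\<tau> j)" if "i < k + l \<and> j < k + l"
      unfolding hat_def dsum_def \<tau>_def mstar_def using that by auto
    ultimately show "hat k x i j = (if i < k + l \<and> j < k + l then dsum k l x (mstar st x) (id i) (\<tau> j) else 0)"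
      by auto
  qed
  then have "nrm (k + l) (k + l) (hat k x) =
      nrm (k + l) (k + l) (\<lambda>i j. if i < k + l \<and> j < k + l then dsum k l x (mstar st x) (id i) (\<tau> j) else 0)"
    by (rule arg_cong)
  also have "\<dots> \<le> nrm (k + l) (l + k) (dsum k l x (mstar st x))"
    by (rule nrm_select[OF kl(1) kl(1) kl(1) kl(2) D])
       (auto simp: \<tau>_def inj_on_def split: if_splits)
  also have "\<dots> = nrm k l x"
    using nrm_dsum[OF k l l k x xs] nrm_star[OF k l x] by simp
  finally show "nrm (k + l) (k + l) (hat k x) \<le> nrm k l x" .
  have "x = (\<lambda>i j. if i < k \<and> j < l then hat k x (id i) (k + j) else 0)"
    using x unfolding mats_def hat_def by (auto simp: fun_eq_iff)
  then have "nrm k l x = nrm k l (\<lambda>i j. if i < k \<and> j < l then hat k x (id i) (k + j) else 0)"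
    by (rule arg_cong)
  also have "\<dots> \<le> nrm (k + l) (k + l) (hat k x)"
    by (rule nrm_select[OF k l kl(1) kl(1) sa_mats_mats[OF hat_sa[OF x]]]) auto
  finally show "nrm k l x \<le> nrm (k + l) (k + l) (hat k x)" .
qed

text \<open>The inner product of \<open>\<phi>^(n,m)(A) \<xi>\<close> with \<open>\<eta>\<close>,
  where each \<open>\<eta> i\<close> and \<open>\<xi> j\<close> is a vector in C^d.\<close>

definition mform :: "nat \<Rightarrow> ('v \<Rightarrow> nat \<Rightarrow> nat \<Rightarrow> complex) \<Rightarrow> nat \<Rightarrow> nat \<Rightarrow> (nat \<Rightarrow> nat \<Rightarrow> 'v) \<Rightarrow>
    (nat \<Rightarrow> nat \<Rightarrow> complex) \<Rightarrow> (nat \<Rightarrow> nat \<Rightarrow> complex) \<Rightarrow> complex" where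
  "mform d \<phi> n m A \<eta> \<xi> = (\<Sum>i<n. \<Sum>j<m. \<Sum>r<d. \<Sum>s<d. cnj (\<eta> i r) * \<phi> (A i j) r s * \<xi> j s)"

definition vecs_sq :: "nat \<Rightarrow> nat \<Rightarrow> (nat \<Rightarrow> nat \<Rightarrow> complex) \<Rightarrow> real" where
  "vecs_sq n d \<eta> = (\<Sum>i<n. \<Sum>r<d. (cmod (\<eta> i r))\<^sup>2)"

text \<open>Complete contractivity and complete positivity of \<open>\<phi>\<close> as a map into the d x d matrices;
  entries of \<open>\<phi> v\<close> outside the index range are constrained only by linearity and symmetry.\<close>
definition cccp :: "('v \<Rightarrow> nat \<Rightarrow> nat \<Rightarrow> complex) \<Rightarrow> nat \<Rightarrow> bool" where
  "cccp \<phi> d \<longleftrightarrow> (\<forall>a v w r s. \<phi> (sc a v + w) r s = a * \<phi> v r s + \<phi> w r s) \<and>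
     (\<forall>v r s. \<phi> (st v) r s = cnj (\<phi> v s r)) \<and>
     (\<forall>n A \<eta>. 1 \<le> n \<longrightarrow> A \<in> pos n \<longrightarrow> 0 \<le> Re (mform d \<phi> n n A \<eta> \<eta>)) \<and>
     (\<forall>n m A \<eta> \<xi>. 1 \<le> n \<longrightarrow> 1 \<le> m \<longrightarrow> A \<in> mats n m \<longrightarrow>
        cmod (mform d \<phi> n m A \<eta> \<xi>) \<le> nrm n m A * sqrt (vecs_sq n d \<eta>) * sqrt (vecs_sq m d \<xi>))"

end

text \<open>An estimate can thus be proved with every factor enlarged to be positive; it survives as
  \<open>e\<close> decreases to 0.\<close>

lemma le_mult_sqrt_limit:
  assumes z: "\<And>e. 0 < e \<Longrightarrow> z \<le> (N + e) * sqrt ((a + e) * (b + e))"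
  shows "z \<le> N * (sqrt a * sqrt b)"
proof -
  have "((\<lambda>e. (N + e) * sqrt ((a + e) * (b + e))) \<longlongrightarrow> (N + 0) * sqrt ((a + 0) * (b + 0))) (at_right 0)"
    by (intro tendsto_intros)
  moreover have "eventually (\<lambda>e. z \<le> (N + e) * sqrt ((a + e) * (b + e))) (at_right 0)"
    using z by (simp add: eventually_at_right_less eventually_mono[OF eventually_at_right_less])
  ultimately have "z \<le> (N + 0) * sqrt ((a + 0) * (b + 0))"
    by (rule tendsto_lowerbound) simp
  then show ?thesis by (simp add: real_sqrt_mult)
qed

section \<open>From the pair of forms to a map into matrices\<close>

context form_pair
begin

lemma B_zero: "B 0 a b = 0"
  using B_lin[of 1 0 0 a b] by simp

lemma B_vscale: "B (sc c v) a b = c * B v a b"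
  using B_lin[of c v 0 a b] by (simp add: B_zero)

lemma B_add_right: "B v a (\<lambda>t. b t + b' t) = B v a b + B v a b'"
  by (metis B_add B_st complex_cnj_add complex_cnj_cnj)

lemma B_scale_right: "B v a (\<lambda>t. c * b t) = cnj c * B v a b"
  by (metis B_scale B_st complex_cnj_mult complex_cnj_cnj)

lemma B_zero_vec: "B v (\<lambda>t. 0) b = 0" "B v a (\<lambda>t. 0) = 0"
  using B_scale[of v 0 "\<lambda>t. 0" b] B_scale_right[of v a 0 "\<lambda>t. 0"] by simp_all

lemma B_sum: "B v (\<lambda>t. \<Sum>r<d. c r * u r t) b = (\<Sum>r<(d::nat). c r * B v (u r) b)"
  by (induction d) (simp_all add: B_zero_vec B_add B_scale)

lemma B_sum_right: "B v a (\<lambda>t. \<Sum>r<d. c r * u r t) = (\<Sum>r<(d::nat). cnj (c r) * B v a (u r))"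
  by (induction d) (simp_all add: B_zero_vec B_add_right B_scale_right)

text \<open>The diagonal blocks of \<open>hat k x\<close> vanish, and the other two give conjugate
  sums by \<open>B_st\<close>.\<close>

lemma B_hat_sum:
  "(\<Sum>p<k+l. \<Sum>q<k+l. B (hat k x p q) (f p) (f q)) =
    (\<Sum>p<k. \<Sum>q<l. B (x p q) (f p) (f (k + q))) + cnj (\<Sum>p<k. \<Sum>q<l. B (x p q) (f p) (f (k + q)))"
proof -
  have "(\<Sum>p<k+l. \<Sum>q<k+l. B (hat k x p q) (f p) (f q)) =
     (\<Sum>p<k. \<Sum>q<l. B (x p q) (f p) (f (k + q))) + (\<Sum>p<l. \<Sum>q<k. B (st (x q p)) (f (k + p)) (f q))"
    unfolding sum_lessThan_add hat_def by (simp add: B_zero)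
  also have "(\<Sum>p<l. \<Sum>q<k. B (st (x q p)) (f (k + p)) (f q)) = cnj (\<Sum>p<k. \<Sum>q<l. B (x p q) (f p) (f (k + q)))"
    unfolding B_st by (subst sum.swap) simp
  finally show ?thesis .
qed

text \<open>The bound for self-adjoint matrices is applied to \<open>hat k x\<close> with the vectors rescaled by a phase
  and by \<open>r\<close> and \<open>1/r\<close>; \<open>e\<close> keeps all three factors positive so that the optimal \<open>r\<close> exists.\<close>
lemma B_cs:
  assumes k: "1 \<le> k" and l: "1 \<le> l" and x: "x \<in> mats k l"
  shows "cmod (\<Sum>p<k. \<Sum>q<l. B (x p q) (a p) (b q)) \<le>
    nrm k l x * (sqrt (\<Sum>p<k. Re (P (a p) (a p))) * sqrt (\<Sum>q<l. Re (P (b q) (b q))))"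
proof (rule le_mult_sqrt_limit)
  fix e :: real assume e: "0 < e"
  define Z where "Z = (\<Sum>p<k. \<Sum>q<l. B (x p q) (a p) (b q))"
  define S where "S = (\<Sum>p<k. Re (P (a p) (a p))) + e"
  define T where "T = (\<Sum>q<l. Re (P (b q) (b q))) + e"
  define N where "N = nrm k l x + e"
  have S: "0 < S" "0 < T" "0 < N"
    using e nrm_nonneg[OF k l x] P_nonneg unfolding S_def T_def N_def by (auto intro!: add_nonneg_pos sum_nonneg)
  \<comment> \<open>This \<open>r\<close> balances the two terms of \<open>r^2 S + T / r^2\<close>:
    both become \<open>sqrt (S T)\<close>.\<close>
  define r where "r = sqrt (sqrt (T / S))"
  have r: "0 < r" "r\<^sup>2 = sqrt (T / S)" unfolding r_def using S by simp_all
  define \<omega> where "\<omega> = (if Z = 0 then 1 else cnj Z / of_real (cmod Z))"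
  have \<omega>: "cmod \<omega> = 1" unfolding \<omega>_def by (simp add: norm_divide)
  have \<omega>Z: "\<omega> * Z = of_real (cmod Z)"
    unfolding \<omega>_def using complex_norm_square[of Z] by (auto simp: field_simps power2_eq_square)
  define \<mu> where "\<mu> = \<omega> * of_real r"
  define \<nu> where "\<nu> = complex_of_real (1 / r)"
  have \<mu>\<nu>: "\<mu> * cnj \<nu> = \<omega>" "\<mu> * cnj \<mu> = of_real (r\<^sup>2)" "\<nu> * cnj \<nu> = of_real (1 / r\<^sup>2)"
    unfolding complex_norm_square[symmetric] using r(1) \<omega> unfolding \<mu>_def \<nu>_def
    by (simp_all add: norm_mult norm_divide power_divide)
  define c where "c p = (if p < k then (\<lambda>t. \<mu> * a p t) else (\<lambda>t. \<nu> * b (p - k) t))" for p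
  define y where "y = mscale sc (of_real (1 / N)) x"
  have y: "y \<in> mats k l" using x unfolding y_def mscale_def mats_def by auto
  have "nrm k l y = nrm k l x / N" unfolding y_def nrm_scale[OF k l x] using S by (simp add: norm_divide)
  also have "\<dots> \<le> 1" using S e unfolding N_def by simp
  finally have ny: "nrm (k + l) (k + l) (hat k y) \<le> 1" unfolding nrm_hat[OF k l y] .
  have 1: "(\<Sum>p<k. \<Sum>q<l. B (y p q) (c p) (c (k + q))) = of_real (cmod Z / N)"
  proof -
    have "B (y p q) (c p) (c (k + q)) = (of_real (1 / N) * \<omega>) * B (x p q) (a p) (b q)" if "p < k" for p q
      using that unfolding y_def mscale_def c_def \<mu>\<nu>(1)[symmetric] by (simp add: B_vscale B_scale B_scale_right)
    then have "(\<Sum>p<k. \<Sum>q<l. B (y p q) (c p) (c (k + q))) = (of_real (1 / N) * \<omega>) * Z"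
      unfolding Z_def sum_distrib_left by simp
    then show ?thesis using \<omega>Z by simp
  qed
  have "2 * (cmod Z / N) = Re (\<Sum>p<k+l. \<Sum>q<k+l. B (hat k y p q) (c p) (c q))"
    unfolding B_hat_sum 1 by simp
  also have "\<dots> \<le> (\<Sum>p<k+l. Re (P (c p) (c p)))"
    by (rule B_bound[OF _ hat_sa[OF y] ny]) (use k in simp)
  also have "\<dots> = (\<Sum>p<k. r\<^sup>2 * Re (P (a p) (a p))) + (\<Sum>q<l. (1 / r\<^sup>2) * Re (P (b q) (b q)))"
  proof -
    have "P (c p) (c p) = of_real (r\<^sup>2) * P (a p) (a p)" if "p < k" for p
      using that unfolding c_def \<mu>\<nu>(2)[symmetric] by (simp add: P_scale P_scale_right)
    moreover have "P (c (k + q)) (c (k + q)) = of_real (1 / r\<^sup>2) * P (b q) (b q)" for q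
      unfolding c_def \<mu>\<nu>(3)[symmetric] by (simp add: P_scale P_scale_right)
    ultimately show ?thesis unfolding sum_lessThan_add by (simp del: of_real_divide of_real_power)
  qed
  also have "\<dots> \<le> r\<^sup>2 * S + (1 / r\<^sup>2) * T"
    unfolding sum_distrib_left[symmetric] S_def T_def using e r(1)
    by (intro add_mono mult_left_mono) auto
  also have "\<dots> = 2 * sqrt (S * T)"
  proof -
    have "r\<^sup>2 * S = sqrt (S * T)"
      unfolding r(2) using S by (simp add: real_sqrt_divide real_sqrt_mult field_simps)
    moreover have "(1 / r\<^sup>2) * T = sqrt (S * T)"
      unfolding r(2) using S by (simp add: real_sqrt_divide real_sqrt_mult field_simps)
    ultimately show ?thesis by simp
  qed
  finally have "cmod Z \<le> N * sqrt (S * T)" using S by (simp add: field_simps)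
  then show "cmod (\<Sum>p<k. \<Sum>q<l. B (x p q) (a p) (b q))
      \<le> (nrm k l x + e) * sqrt (((\<Sum>p<k. Re (P (a p) (a p))) + e) * ((\<Sum>q<l. Re (P (b q) (b q))) + e))"
    unfolding Z_def N_def S_def T_def .
qed

text \<open>The case of the 1 x 1 matrix \<open>v\<close> in \<open>B_cs\<close>. It makes the forms
  \<open>B v\<close> insensitive to null vectors of \<open>P\<close>.\<close>

lemma B_null:
  assumes "Re (P z z) = 0"
  shows "B v z b = 0" "B v b z = 0"
proof -
  have *: "B v z b = 0" for v
  proof -
    have "(\<lambda>i j. if i = 0 \<and> j = 0 then v else 0) \<in> mats 1 1" unfolding mats_def by auto
    from B_cs[OF order_refl order_refl this, of "\<lambda>_. z" "\<lambda>_. b"] show ?thesis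
      using assms by simp
  qed
  show "B v z b = 0" by (rule *)
  show "B v b z = 0" using B_st[of "st v" b z] *[of "st v"] by simp
qed

text \<open>\<open>\<phi> v\<close> is the matrix of the form \<open>B v\<close> in a Gram-Schmidt
  family for \<open>P\<close>. Null remainders affect neither \<open>P\<close> nor \<open>B\<close>,
  so the coordinates of the vectors \<open>e i\<close> reproduce the values of the forms
  there.\<close>

lemma cccp_from_forms:
  assumes A: "1 \<le> n" and P1: "(\<Sum>i<n. Re (P (e i) (e i))) \<le> 1"
  shows "\<exists>\<phi> d \<eta>. cccp \<phi> d \<and> vecs_sq n d \<eta> \<le> 1 \<and>
    mform d \<phi> n n A \<eta> \<eta> = (\<Sum>i<n. \<Sum>j<n. B (A i j) (e i) (e j))"
proof -
  obtain d :: nat and u where on: "\<forall>r<d. \<forall>s<d. P (u r) (u s) = (if r = s then 1 else 0)"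
    and ex: "\<forall>i<n. \<exists>c z. e i = (\<lambda>t. (\<Sum>r<d. c r * u r t) + z t) \<and> Re (P z z) = 0"
    using gram_schmidt[of n e] by blast
  define \<phi> where "\<phi> v r s = B v (u r) (u s)" for v r s
  \<comment> \<open>Coordinates are conjugated because \<open>B\<close> is linear in its first
    argument while \<open>mform\<close> is conjugate-linear in \<open>\<eta>\<close>.\<close>
  define vec where "vec \<eta> i = (\<lambda>t. \<Sum>r<d. cnj (\<eta> i r) * u r t)" for \<eta> :: "nat \<Rightarrow> nat \<Rightarrow> complex" and i
  have P_vec: "Re (P (vec \<eta> i) (vec \<eta> i)) = (\<Sum>r<d. (cmod (\<eta> i r))\<^sup>2)" for \<eta> i
  proof -
    have "P (vec \<eta> i) (vec \<eta> i) = (\<Sum>r<d. cnj (\<eta> i r) * (\<Sum>s<d. \<eta> i s * P (u r) (u s)))"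
      unfolding vec_def P_sum P_sum_right by simp
    also have "\<dots> = (\<Sum>r<d. cnj (\<eta> i r) * (\<Sum>s<d. if s = r then \<eta> i s else 0))"
      using on by (intro sum.cong refl arg_cong2[of _ _ _ _ "(*)"]) auto
    also have "\<dots> = (\<Sum>r<d. complex_of_real ((cmod (\<eta> i r))\<^sup>2))"
      by (intro sum.cong refl) (simp add: complex_norm_square mult.commute del: of_real_power)
    finally show ?thesis by (simp del: of_real_power)
  qed
  have mform: "mform d \<phi> k l x \<eta> \<xi> = (\<Sum>p<k. \<Sum>q<l. B (x p q) (vec \<eta> p) (vec \<xi> q))" for k l x \<eta> \<xi>
    unfolding mform_def vec_def B_sum B_sum_right \<phi>_def sum_distrib_left complex_cnj_cnj
    by (intro sum.cong refl) (simp only: mult.assoc mult.commute[of "B _ _ _"])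
  have vecs_sq: "vecs_sq k d \<eta> = (\<Sum>p<k. Re (P (vec \<eta> p) (vec \<eta> p)))" for k \<eta>
    unfolding vecs_sq_def P_vec ..
  have "cccp \<phi> d"
    unfolding cccp_def
  proof (intro conjI allI impI)
    show "\<phi> (sc a v + w) r s = a * \<phi> v r s + \<phi> w r s" for a v w r s
      unfolding \<phi>_def by (rule B_lin)
    show "\<phi> (st v) r s = cnj (\<phi> v s r)" for v r s
      unfolding \<phi>_def by (rule B_st)
    show "0 \<le> Re (mform d \<phi> k k x \<eta> \<eta>)" if "1 \<le> k" "x \<in> pos k" for k x \<eta>
      unfolding mform using that by (rule B_pos)
    show "cmod (mform d \<phi> k l x \<eta> \<xi>) \<le> nrm k l x * sqrt (vecs_sq k d \<eta>) * sqrt (vecs_sq l d \<xi>)"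
      if "1 \<le> k" "1 \<le> l" "x \<in> mats k l" for k l x \<eta> \<xi>
      unfolding mform vecs_sq using B_cs[OF that] by (simp add: mult.assoc)
  qed
  obtain c z where e: "\<And>i. i < n \<Longrightarrow> e i = (\<lambda>t. (\<Sum>r<d. c i r * u r t) + z i t)"
    and z: "\<And>i. i < n \<Longrightarrow> Re (P (z i) (z i)) = 0"
    using ex by metis
  define \<eta> where "\<eta> i r = cnj (c i r)" for i r
  have e': "e i = (\<lambda>t. vec \<eta> i t + z i t)" if "i < n" for i
    using e[OF that] unfolding vec_def \<eta>_def by simp
  have "Re (P (vec \<eta> i) (vec \<eta> i)) = Re (P (e i) (e i))" if "i < n" for i
    unfolding e'[OF that] P_add P_add_right
    using P_null[OF z[OF that]] P_cnj[of "vec \<eta> i" "z i"] by simp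
  then have "vecs_sq n d \<eta> \<le> 1" unfolding vecs_sq using P1 by simp
  moreover have "B v (vec \<eta> i) (vec \<eta> j) = B v (e i) (e j)" if "i < n" "j < n" for v i j
    unfolding e'[OF that(1)] e'[OF that(2)] B_add B_add_right
    using B_null[OF z[OF that(1)]] B_null[OF z[OF that(2)]] by simp
  then have "mform d \<phi> n n A \<eta> \<eta> = (\<Sum>i<n. \<Sum>j<n. B (A i j) (e i) (e j))"
    unfolding mform by simp
  ultimately show ?thesis using \<open>cccp \<phi> d\<close> by blast
qed

end

context normal_space
begin

text \<open>Later arguments see the Hahn-Banach functional only through this map and a vector of
  norm at most 1 at which the gauge is attained.\<close>

lemma cccp_exists:
  assumes n: "1 \<le> n" and A: "A \<in> sa_mats st n"
  obtains \<phi> d \<eta> where "cccp \<phi> d" "vecs_sq n d \<eta> \<le> 1" "Re (mform d \<phi> n n A \<eta> \<eta>) = gauge n (0, A)"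
proof -
  obtain P B where fp: "form_pair sc st nrm pos P B"
    and PB: "(\<Sum>i<n. Re (P (unit_vec i) (unit_vec i))) \<le> 1"
    "Re (\<Sum>i<n. \<Sum>j<n. B (A i j) (unit_vec i) (unit_vec j)) = gauge n (0, A)"
    using form_pair_exists[OF n A] by blast
  interpret F: form_pair sc st nrm pos P B by (rule fp)
  show ?thesis using F.cccp_from_forms[OF n PB(1), of A] PB(2) that by metis
qed

end


section \<open>The block diagonal representation\<close>

lemma summable_on_finite_sum:
  fixes f :: "nat \<Rightarrow> 'a \<Rightarrow> 'b::{topological_comm_monoid_add,t2_space}"
  assumes "\<And>i. i < n \<Longrightarrow> f i summable_on S"
  shows "(\<lambda>t. \<Sum>i<n. f i t) summable_on S"
    and "infsum (\<lambda>t. \<Sum>i<n. f i t) S = (\<Sum>i<n. infsum (f i) S)"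
  using assms by (induction n) (simp_all add: summable_on_add infsum_add)

lemma l2_mult_summable:
  assumes "x \<in> l2 I" "y \<in> l2 I"
  shows "(\<lambda>t. x t * cnj (y t)) summable_on I"
proof (rule abs_summable_summable, rule abs_summable_product)
  show "(\<lambda>t. norm (x t * x t)) summable_on I" "(\<lambda>t. norm (cnj (y t) * cnj (y t))) summable_on I"
    using assms unfolding l2_def by (auto simp: norm_mult power2_eq_square)
qed

lemma l2norm_sq: "(l2norm I x)\<^sup>2 = infsum (\<lambda>t. (cmod (x t))\<^sup>2) I"
  unfolding l2norm_def by (simp add: infsum_nonneg)

lemma hn_norm_sq: "(hn_norm I n x)\<^sup>2 = (\<Sum>i<n. infsum (\<lambda>t. (cmod (x i t))\<^sup>2) I)"
  unfolding hn_norm_def l2norm_sq by (simp add: sum_nonneg infsum_nonneg)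

lemma hn_norm_nonneg: "0 \<le> hn_norm I n x"
  unfolding hn_norm_def by (simp add: sum_nonneg)

context normal_space
begin

definition blocks :: "(('v \<Rightarrow> nat \<Rightarrow> nat \<Rightarrow> complex) \<times> nat) set" where
  "blocks = {(\<phi>, d). cccp \<phi> d}"

text \<open>The coordinates of the direct sum of the spaces C^d over all pairs in
  \<open>blocks\<close>; all admissible maps are taken at once instead of one for each
  matrix.\<close>

definition idx :: "(('v \<Rightarrow> nat \<Rightarrow> nat \<Rightarrow> complex) \<times> nat \<times> nat) set" where
  "idx = {(\<phi>, d, r). cccp \<phi> d \<and> r < d}"

text \<open>The block diagonal operator with blocks \<open>\<phi> v\<close>. Off \<open>idx\<close>
  it returns 0, as membership in \<open>l2 idx\<close> requires.\<close>

definition rep :: "'v \<Rightarrow> ((('v \<Rightarrow> nat \<Rightarrow> nat \<Rightarrow> complex) \<times> nat \<times> nat) \<Rightarrow> complex) \<Rightarrow>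
    (('v \<Rightarrow> nat \<Rightarrow> nat \<Rightarrow> complex) \<times> nat \<times> nat) \<Rightarrow> complex" where
  "rep v x = (\<lambda>(\<phi>, d, r). if cccp \<phi> d \<and> r < d then \<Sum>s<d. \<phi> v r s * x (\<phi>, d, s) else 0)"

lemma rep_apply: "rep v x (\<phi>, d, r) = (if cccp \<phi> d \<and> r < d then \<Sum>s<d. \<phi> v r s * x (\<phi>, d, s) else 0)"
  unfolding rep_def by simp

definition blk :: "(('v \<Rightarrow> nat \<Rightarrow> nat \<Rightarrow> complex) \<times> nat) \<times> nat \<Rightarrow> ('v \<Rightarrow> nat \<Rightarrow> nat \<Rightarrow> complex) \<times> nat \<times> nat" where
  "blk z = (fst (fst z), snd (fst z), snd z)"

lemma inj_blk: "inj blk"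
  unfolding blk_def inj_def by auto

lemma bij_blk: "bij_betw blk (SIGMA b:blocks. {..<snd b}) idx"
  unfolding bij_betw_def
proof
  show "inj_on blk (SIGMA b:blocks. {..<snd b})" using inj_blk by (rule inj_on_subset) simp
  show "blk ` (SIGMA b:blocks. {..<snd b}) = idx"
    unfolding blk_def idx_def blocks_def by force
qed

text \<open>Single terms may be negative and only sums over a block are controlled, so the sum is
  regrouped by blocks.\<close>

lemma idx_infsum_nonneg:
  fixes g :: "_ \<Rightarrow> real"
  assumes g: "g summable_on idx" and b: "\<And>\<phi> d. cccp \<phi> d \<Longrightarrow> 0 \<le> (\<Sum>r<d. g (\<phi>, d, r))"
  shows "0 \<le> infsum g idx"
proof -
  have s: "(\<lambda>z. g (blk z)) summable_on (SIGMA b:blocks. {..<snd b})"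
    using g summable_on_reindex_bij_betw[OF bij_blk, of g] by blast
  have "infsum g idx = infsum (\<lambda>z. g (blk z)) (SIGMA b:blocks. {..<snd b})"
    by (rule infsum_reindex_bij_betw[OF bij_blk, symmetric])
  also have "\<dots> = infsum (\<lambda>b. infsum (\<lambda>r. g (blk (b, r))) {..<snd b}) blocks"
    by (rule infsum_Sigma_banach[OF s, symmetric])
  also have "\<dots> \<ge> 0"
    by (rule infsum_nonneg) (use b in \<open>auto simp: blocks_def blk_def\<close>)
  finally show ?thesis .
qed

text \<open>Blocks are finite, so each finite set of indices lies in a finite union of whole blocks,
  where the block estimates can be added.\<close>

lemma idx_infsum_mono:
  fixes u w :: "_ \<Rightarrow> real"
  assumes u: "u summable_on idx" "\<And>t. 0 \<le> u t" and w: "\<And>t. 0 \<le> w t" and c: "0 \<le> c"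
    and b: "\<And>\<phi> d. cccp \<phi> d \<Longrightarrow> (\<Sum>r<d. w (\<phi>, d, r)) \<le> c * (\<Sum>r<d. u (\<phi>, d, r))"
  shows "w summable_on idx" "infsum w idx \<le> c * infsum u idx"
proof -
  have fin: "sum w F \<le> c * infsum u idx" if F: "finite F" "F \<subseteq> idx" for F
  proof -
    define K where "K = (\<lambda>(\<phi>, d, r). (\<phi>, d)) ` F"
    define T where "T = blk ` (SIGMA b:K. {..<snd b})"
    have K: "finite K" "K \<subseteq> blocks" using F unfolding K_def blocks_def idx_def by auto
    have sumT: "sum h T = (\<Sum>b\<in>K. \<Sum>r<snd b. h (fst b, snd b, r))" for h :: "_ \<Rightarrow> real"
    proof -
      have "sum h T = (\<Sum>z\<in>(SIGMA b:K. {..<snd b}). h (blk z))"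
        unfolding T_def by (subst sum.reindex) (use inj_blk inj_on_subset in auto)
      also have "\<dots> = (\<Sum>b\<in>K. \<Sum>r<snd b. h (blk (b, r)))"
        by (subst sum.Sigma) (use K in \<open>auto simp: split_def\<close>)
      finally show ?thesis by (simp add: blk_def)
    qed
    have T: "finite T" "F \<subseteq> T" "T \<subseteq> idx"
    proof -
      show "finite T" unfolding T_def using K by auto
      show "F \<subseteq> T"
      proof
        fix t assume t: "t \<in> F"
        obtain \<phi> d r where tt: "t = (\<phi>, d, r)" by (cases t)
        have "(\<phi>, d) \<in> K" using t unfolding tt K_def by force
        moreover have "r < d" using t F(2) unfolding tt idx_def by auto
        ultimately have "((\<phi>, d), r) \<in> (SIGMA b:K. {..<snd b})" by simp
        then have "blk ((\<phi>, d), r) \<in> T" unfolding T_def by (rule imageI)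
        then show "t \<in> T" unfolding tt blk_def by simp
      qed
      show "T \<subseteq> idx" using K(2) unfolding T_def blk_def idx_def blocks_def by auto
    qed
    have "sum w F \<le> sum w T" by (rule sum_mono2) (use T w in auto)
    also have "\<dots> \<le> (\<Sum>b\<in>K. c * (\<Sum>r<snd b. u (fst b, snd b, r)))"
      unfolding sumT by (rule sum_mono) (use b K(2) in \<open>auto simp: blocks_def\<close>)
    also have "\<dots> = c * sum u T" unfolding sumT sum_distrib_left ..
    also have "\<dots> \<le> c * infsum u idx"
      by (intro mult_left_mono[OF _ c] finite_sum_le_infsum) (use T u in auto)
    finally show ?thesis .
  qed
  show "w summable_on idx"
    by (rule nonneg_bdd_above_summable_on) (use w fin in \<open>auto intro!: bdd_aboveI\<close>)
  then show "infsum w idx \<le> c * infsum u idx"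
    by (rule infsum_le_finite_sums) (rule fin)
qed

section \<open>Forms and action of a matrix on one block\<close>

lemma cccp_lin: "cccp \<phi> d \<Longrightarrow> \<phi> (sc a v + w) r s = a * \<phi> v r s + \<phi> w r s"
  and cccp_st: "cccp \<phi> d \<Longrightarrow> \<phi> (st v) r s = cnj (\<phi> v s r)"
  and cccp_pos: "cccp \<phi> d \<Longrightarrow> 1 \<le> n \<Longrightarrow> A \<in> pos n \<Longrightarrow> 0 \<le> Re (mform d \<phi> n n A \<eta> \<eta>)"
  and cccp_cc: "cccp \<phi> d \<Longrightarrow> 1 \<le> n \<Longrightarrow> 1 \<le> m \<Longrightarrow> A \<in> mats n m \<Longrightarrow>
        cmod (mform d \<phi> n m A \<eta> \<xi>) \<le> nrm n m A * sqrt (vecs_sq n d \<eta>) * sqrt (vecs_sq m d \<xi>)"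
  unfolding cccp_def by blast+

lemma cccp_scale: "cccp \<phi> d \<Longrightarrow> \<phi> (sc a v) r s = a * \<phi> v r s"
  using cccp_lin[of \<phi> d a v 0 r s] cccp_lin[of \<phi> d 1 0 0 r s] by simp

lemma cccp_zero: "cccp \<phi> d \<Longrightarrow> \<phi> 0 r s = 0"
  using cccp_scale[of \<phi> d 0 0 r s] by simp

lemma vecs_sq_nonneg: "0 \<le> vecs_sq n d \<eta>"
  unfolding vecs_sq_def by (simp add: sum_nonneg)

lemma mform_scale: "cccp \<phi> d \<Longrightarrow> mform d \<phi> n m (mscale sc a A) \<eta> \<xi> = a * mform d \<phi> n m A \<eta> \<xi>"
  unfolding mform_def mscale_def by (simp add: cccp_scale sum_distrib_left ac_simps)

lemma mform_add: "cccp \<phi> d \<Longrightarrow> mform d \<phi> n m (A + B) \<eta> \<xi> = mform d \<phi> n m A \<eta> \<xi> + mform d \<phi> n m B \<eta> \<xi>"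
  unfolding mform_def using cccp_lin[of \<phi> d 1] by (simp add: sum.distrib[symmetric] algebra_simps)

lemma mform_star:
  assumes "cccp \<phi> d"
  shows "mform d \<phi> m n (mstar st A) \<xi> \<eta> = cnj (mform d \<phi> n m A \<eta> \<xi>)"
proof -
  have "cnj (mform d \<phi> n m A \<eta> \<xi>) = (\<Sum>i<n. \<Sum>j<m. \<Sum>r<d. \<Sum>s<d. cnj (\<xi> j s) * \<phi> (st (A i j)) s r * \<eta> i r)"
    unfolding mform_def by (simp add: cccp_st[OF assms] ac_simps)
  also have "\<dots> = (\<Sum>j<m. \<Sum>i<n. \<Sum>r<d. \<Sum>s<d. cnj (\<xi> j s) * \<phi> (st (A i j)) s r * \<eta> i r)"
    by (rule sum.swap)
  also have "\<dots> = (\<Sum>j<m. \<Sum>i<n. \<Sum>s<d. \<Sum>r<d. cnj (\<xi> j s) * \<phi> (st (A i j)) s r * \<eta> i r)"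
    by (rule sum.cong[OF refl], rule sum.cong[OF refl], rule sum.swap)
  finally show ?thesis unfolding mform_def mstar_def ..
qed

text \<open>Component \<open>i\<close> of \<open>\<phi>^(n,m)(A) \<xi>\<close>, a vector in
  C^d.\<close>

definition block_act :: "nat \<Rightarrow> ('v \<Rightarrow> nat \<Rightarrow> nat \<Rightarrow> complex) \<Rightarrow> nat \<Rightarrow> (nat \<Rightarrow> nat \<Rightarrow> 'v) \<Rightarrow> (nat \<Rightarrow> nat \<Rightarrow> complex) \<Rightarrow>
    nat \<Rightarrow> nat \<Rightarrow> complex" where
  "block_act d \<phi> m A \<xi> i r = (\<Sum>j<m. \<Sum>s<d. \<phi> (A i j) r s * \<xi> j s)"

lemma mform_act: "mform d \<phi> n m A \<eta> \<xi> = (\<Sum>i<n. \<Sum>r<d. cnj (\<eta> i r) * block_act d \<phi> m A \<xi> i r)"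
  unfolding mform_def block_act_def sum_distrib_left mult.assoc
  by (rule sum.cong[OF refl], rule sum.swap)

lemma mform_act_self: "mform d \<phi> n m A (block_act d \<phi> m A \<xi>) \<xi> = of_real (vecs_sq n d (block_act d \<phi> m A \<xi>))"
  unfolding mform_act vecs_sq_def of_real_sum complex_norm_square by (simp add: mult.commute)

text \<open>The bound on the form is tested at \<open>\<eta> = \<phi>^(n,m)(A) \<xi>\<close>, where
  the form equals the square norm \<open>S\<close> of \<open>\<eta>\<close>; then a factor
  \<open>sqrt S\<close> cancels.\<close>

lemma vecs_sq_act_le:
  assumes g: "cccp \<phi> d" and n: "1 \<le> n" and m: "1 \<le> m" and A: "A \<in> mats n m"
  shows "vecs_sq n d (block_act d \<phi> m A \<xi>) \<le> (nrm n m A)\<^sup>2 * vecs_sq m d \<xi>"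
proof -
  define S where "S = vecs_sq n d (block_act d \<phi> m A \<xi>)"
  have S0: "0 \<le> S" unfolding S_def by (rule vecs_sq_nonneg)
  have "S \<le> nrm n m A * sqrt S * sqrt (vecs_sq m d \<xi>)"
    using cccp_cc[OF g n m A, of "block_act d \<phi> m A \<xi>" \<xi>] S0 unfolding mform_act_self S_def by simp
  then have "sqrt S * sqrt S \<le> sqrt S * (nrm n m A * sqrt (vecs_sq m d \<xi>))" using S0 by (simp add: ac_simps)
  then have "sqrt S \<le> nrm n m A * sqrt (vecs_sq m d \<xi>)"
    using mult_left_le_imp_le[of "sqrt S" "sqrt S"] S0 nrm_nonneg[OF n m A] vecs_sq_nonneg[of m d \<xi>]
    by (cases "S = 0") (auto simp del: real_sqrt_mult_self mult_le_cancel_left_pos)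
  then have "(sqrt S)\<^sup>2 \<le> (nrm n m A * sqrt (vecs_sq m d \<xi>))\<^sup>2" using S0 by (intro power_mono) auto
  then show ?thesis using S0 vecs_sq_nonneg[of m d \<xi>] unfolding S_def by (simp add: power_mult_distrib)
qed

lemma opmat_apply_rep:
  "opmat_apply m (\<lambda>i j. rep (A i j)) x i (\<phi>, d, r) =
    (if cccp \<phi> d \<and> r < d then block_act d \<phi> m A (\<lambda>j s. x j (\<phi>, d, s)) i r else 0)"
  unfolding opmat_apply_def block_act_def rep_apply by (cases "cccp \<phi> d \<and> r < d") (simp_all only: if_True if_False simp_thms sum.neutral_const)

text \<open>The estimates on single blocks add up to one on all of \<open>l2 idx\<close>; the
  comparison also yields square summability of each \<open>y i\<close>.\<close>

lemma opmat_rep_bound: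
  assumes n: "1 \<le> n" and m: "1 \<le> m" and A: "A \<in> mats n m" and x: "\<And>j. j < m \<Longrightarrow> x j \<in> l2 idx"
  defines "y \<equiv> opmat_apply m (\<lambda>i j. rep (A i j)) x"
  shows "\<And>i. i < n \<Longrightarrow> y i \<in> l2 idx" "hn_norm idx n y \<le> nrm n m A * hn_norm idx m x"
proof -
  define u where "u t = (\<Sum>j<m. (cmod (x j t))\<^sup>2)" for t
  define w where "w t = (\<Sum>i<n. (cmod (y i t))\<^sup>2)" for t
  have xs: "(\<lambda>t. (cmod (x j t))\<^sup>2) summable_on idx" if "j < m" for j
    using x[OF that] unfolding l2_def by blast
  have u: "u summable_on idx" "infsum u idx = (hn_norm idx m x)\<^sup>2"
    unfolding u_def hn_norm_sq
    using summable_on_finite_sum[of m "\<lambda>j t. (cmod (x j t))\<^sup>2" idx] xs by auto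
  have u0: "0 \<le> u t" and w0: "0 \<le> w t" for t unfolding u_def w_def by (simp_all add: sum_nonneg)
  have blk: "(\<Sum>r<d. w (\<phi>, d, r)) \<le> (nrm n m A)\<^sup>2 * (\<Sum>r<d. u (\<phi>, d, r))" if g: "cccp \<phi> d" for \<phi> d
  proof -
    have "(\<Sum>r<d. w (\<phi>, d, r)) = vecs_sq n d (block_act d \<phi> m A (\<lambda>j s. x j (\<phi>, d, s)))"
      unfolding w_def y_def opmat_apply_rep vecs_sq_def using g by (subst sum.swap) simp
    also have "\<dots> \<le> (nrm n m A)\<^sup>2 * vecs_sq m d (\<lambda>j s. x j (\<phi>, d, s))" by (rule vecs_sq_act_le[OF g n m A])
    also have "vecs_sq m d (\<lambda>j s. x j (\<phi>, d, s)) = (\<Sum>r<d. u (\<phi>, d, r))"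
      unfolding u_def vecs_sq_def by (rule sum.swap)
    finally show ?thesis .
  qed
  have w: "w summable_on idx" "infsum w idx \<le> (nrm n m A)\<^sup>2 * infsum u idx"
    using idx_infsum_mono[of u w "(nrm n m A)\<^sup>2"] u(1) u0 w0 blk by auto
  have ys: "(\<lambda>t. (cmod (y i t))\<^sup>2) summable_on idx" if "i < n" for i
    by (rule summable_on_comparison_test[OF w(1)])
       (use that in \<open>auto simp: w_def intro!: member_le_sum\<close>)
  show "y i \<in> l2 idx" if "i < n" for i
    using ys[OF that] unfolding l2_def y_def by (auto simp: opmat_apply_rep idx_def)
  have "(hn_norm idx n y)\<^sup>2 = infsum w idx"
    unfolding hn_norm_sq w_def using summable_on_finite_sum(2)[of n "\<lambda>j t. (cmod (y j t))\<^sup>2" idx] ys by auto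
  also have "\<dots> \<le> (nrm n m A * hn_norm idx m x)\<^sup>2" using w(2) u(2) by (simp add: power_mult_distrib)
  finally show "hn_norm idx n y \<le> nrm n m A * hn_norm idx m x"
    by (rule power2_le_imp_le) (simp add: nrm_nonneg[OF n m A] hn_norm_nonneg)
qed

lemma rep_linear_into_B: "linear_into_B sc idx rep"
  unfolding linear_into_B_def bounded_op_def
proof (intro conjI allI ballI)
  fix v :: 'v
  \<comment> \<open>Boundedness of \<open>rep v\<close> is the case of the 1 x 1 matrix with entry
    \<open>v\<close>.\<close>
  define A where "A = (\<lambda>i j. if i = (0::nat) \<and> j = (0::nat) then v else 0)"
  have A: "A \<in> mats 1 1" unfolding A_def mats_def by auto
  have y: "opmat_apply 1 (\<lambda>i j. rep (A i j)) (\<lambda>_. x) 0 = rep v x" for x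
    unfolding opmat_apply_def A_def by simp
  have hn: "hn_norm idx 1 z = l2norm idx (z 0)" for z
    unfolding hn_norm_def by (simp add: l2norm_def infsum_nonneg)
  have *: "rep v x \<in> l2 idx" "l2norm idx (rep v x) \<le> nrm 1 1 A * l2norm idx x" if "x \<in> l2 idx" for x
    using opmat_rep_bound(1)[OF order_refl order_refl A, of "\<lambda>_. x" 0]
      opmat_rep_bound(2)[OF order_refl order_refl A, of "\<lambda>_. x"] that unfolding hn y by simp_all
  show "rep v x \<in> l2 idx" if "x \<in> l2 idx" for x using *(1)[OF that] .
  show "\<exists>K. \<forall>x\<in>l2 idx. l2norm idx (rep v x) \<le> K * l2norm idx x" using *(2) by blast
  show "rep v (\<lambda>i. c * x i + y i) = (\<lambda>i. c * rep v x i + rep v y i)" for x y c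
    by (auto simp: fun_eq_iff rep_apply sum_distrib_left sum.distrib[symmetric] algebra_simps)
next
  show "rep (sc a v + w) x = (\<lambda>t. a * rep v x t + rep w x t)" for a v w x
    by (auto simp: fun_eq_iff rep_apply cccp_lin sum_distrib_left sum.distrib[symmetric] distrib_right mult.assoc)
qed

section \<open>Vectors supported in one block\<close>

definition emb :: "('v \<Rightarrow> nat \<Rightarrow> nat \<Rightarrow> complex) \<Rightarrow> nat \<Rightarrow> (nat \<Rightarrow> complex) \<Rightarrow>
    (('v \<Rightarrow> nat \<Rightarrow> nat \<Rightarrow> complex) \<times> nat \<times> nat) \<Rightarrow> complex" where
  "emb \<phi> d \<eta> = (\<lambda>(\<psi>, e, r). if \<psi> = \<phi> \<and> e = d \<and> r < d then \<eta> r else 0)"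

lemma infsum_block:
  fixes h :: "_ \<Rightarrow> 'b::{comm_monoid_add,t2_space}"
  assumes g: "cccp \<phi> d" and h: "\<And>\<psi> e r. \<not> (\<psi> = \<phi> \<and> e = d \<and> r < d) \<Longrightarrow> h (\<psi>, e, r) = 0"
  shows "h summable_on idx" "infsum h idx = (\<Sum>r<d. h (\<phi>, d, r))"
proof -
  define S where "S = (\<lambda>r. (\<phi>, d, r)) ` {..<d}"
  have S: "S \<subseteq> idx" "finite S" unfolding S_def idx_def using g by auto
  have out: "h t = 0" if "t \<in> idx - S" for t
  proof -
    obtain \<psi> e r where t: "t = (\<psi>, e, r)" by (cases t)
    show ?thesis unfolding t by (rule h) (use that in \<open>auto simp: t S_def\<close>)
  qed
  have "h summable_on idx \<longleftrightarrow> h summable_on S"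
    by (rule summable_on_cong_neutral) (use out S in auto)
  then show "h summable_on idx" using S by simp
  have "infsum h idx = infsum h S"
    by (rule infsum_cong_neutral) (use out S in auto)
  also have "\<dots> = (\<Sum>r<d. h (\<phi>, d, r))"
    using S unfolding S_def by (simp add: sum.reindex inj_on_def)
  finally show "infsum h idx = (\<Sum>r<d. h (\<phi>, d, r))" .
qed

lemma emb_l2:
  assumes g: "cccp \<phi> d"
  shows "emb \<phi> d \<eta> \<in> l2 idx"
proof -
  have "(\<lambda>t. (cmod (emb \<phi> d \<eta> t))\<^sup>2) summable_on idx"
    by (rule infsum_block(1)[OF g]) (auto simp: emb_def)
  then show ?thesis unfolding l2_def idx_def emb_def using g by auto
qed

lemma hn_norm_emb:
  assumes g: "cccp \<phi> d"
  shows "hn_norm idx m (\<lambda>j. emb \<phi> d (\<eta> j)) = sqrt (vecs_sq m d \<eta>)"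
proof -
  have "infsum (\<lambda>t. (cmod (emb \<phi> d (\<eta> j) t))\<^sup>2) idx = (\<Sum>r<d. (cmod (\<eta> j r))\<^sup>2)" for j
    by (subst infsum_block(2)[OF g]) (auto simp: emb_def)
  then have "(hn_norm idx m (\<lambda>j. emb \<phi> d (\<eta> j)))\<^sup>2 = vecs_sq m d \<eta>"
    unfolding hn_norm_sq vecs_sq_def by simp
  then show ?thesis using hn_norm_nonneg by (metis real_sqrt_unique)
qed

lemma opmat_apply_emb:
  assumes g: "cccp \<phi> d"
  shows "opmat_apply m (\<lambda>i j. rep (A i j)) (\<lambda>j. emb \<phi> d (\<xi> j)) = (\<lambda>i. emb \<phi> d (block_act d \<phi> m A \<xi> i))"
proof (intro ext)
  fix i and t :: "('v \<Rightarrow> nat \<Rightarrow> nat \<Rightarrow> complex) \<times> nat \<times> nat"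
  obtain \<psi> e r where t: "t = (\<psi>, e, r)" by (cases t)
  show "opmat_apply m (\<lambda>i j. rep (A i j)) (\<lambda>j. emb \<phi> d (\<xi> j)) i t = emb \<phi> d (block_act d \<phi> m A \<xi> i) t"
    unfolding t opmat_apply_rep using g by (auto simp: emb_def block_act_def)
qed

section \<open>The operator norm of the representation\<close>

context
  fixes n m :: nat and A :: "nat \<Rightarrow> nat \<Rightarrow> 'v"
  assumes n: "1 \<le> n" and m: "1 \<le> m" and A: "A \<in> mats n m"
begin

lemma opmat_norm_upper:
  assumes x: "\<And>j. j < m \<Longrightarrow> x j \<in> l2 idx" "hn_norm idx m x \<le> 1"
  shows "hn_norm idx n (opmat_apply m (\<lambda>i j. rep (A i j)) x) \<le> nrm n m A"
proof -
  have "hn_norm idx n (opmat_apply m (\<lambda>i j. rep (A i j)) x) \<le> nrm n m A * hn_norm idx m x"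
    by (rule opmat_rep_bound(2)[OF n m A x(1)])
  also have "\<dots> \<le> nrm n m A * 1" by (rule mult_left_mono[OF x(2) nrm_nonneg[OF n m A]])
  finally show ?thesis by simp
qed

lemma opmat_norm_rep_ge:
  assumes x: "\<And>j. j < m \<Longrightarrow> x j \<in> l2 idx" "hn_norm idx m x \<le> 1"
  shows "hn_norm idx n (opmat_apply m (\<lambda>i j. rep (A i j)) x) \<le> opmat_norm idx n m (\<lambda>i j. rep (A i j))"
  unfolding opmat_norm_def
  by (rule cSup_upper) (use x opmat_norm_upper in \<open>auto intro!: bdd_aboveI[of _ "nrm n m A"]\<close>)

lemma zero_l2: "(\<lambda>t. 0) \<in> l2 idx" "hn_norm idx m (\<lambda>j t. 0) = 0"
  unfolding l2_def hn_norm_def l2norm_def by simp_all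

lemma opmat_norm_rep_le: "opmat_norm idx n m (\<lambda>i j. rep (A i j)) \<le> nrm n m A"
  unfolding opmat_norm_def
proof (rule cSup_least)
  show "{hn_norm idx n (opmat_apply m (\<lambda>i j. rep (A i j)) x) |x. (\<forall>j<m. x j \<in> l2 idx) \<and> hn_norm idx m x \<le> 1} \<noteq> {}"
    using zero_l2 by (auto intro!: exI[of _ "\<lambda>j t. 0"])
qed (use opmat_norm_upper in auto)

lemma opmat_norm_rep_nonneg: "0 \<le> opmat_norm idx n m (\<lambda>i j. rep (A i j))"
  by (rule order_trans[OF hn_norm_nonneg opmat_norm_rep_ge[of "\<lambda>j t. 0"]]) (simp_all add: zero_l2)

text \<open>Vectors supported in the block of \<open>\<phi>\<close> are test vectors for the
  operator norm, and Cauchy-Schwarz pairs their images with \<open>\<eta>\<close>.\<close>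

lemma mform_le_opmat_norm:
  assumes g: "cccp \<phi> d"
  shows "cmod (mform d \<phi> n m A \<eta> \<xi>) \<le> opmat_norm idx n m (\<lambda>i j. rep (A i j)) * (sqrt (vecs_sq n d \<eta>) * sqrt (vecs_sq m d \<xi>))"
    (is "_ \<le> ?M * _")
proof -
  have unit: "cmod (mform d \<phi> n m A \<eta> \<zeta>) \<le> ?M * sqrt (vecs_sq n d \<eta>)" if \<zeta>: "vecs_sq m d \<zeta> \<le> 1" for \<zeta>
  proof -
    have "sqrt (vecs_sq n d (block_act d \<phi> m A \<zeta>)) \<le> ?M"
      using opmat_norm_rep_ge[of "\<lambda>j. emb \<phi> d (\<zeta> j)"] \<zeta> emb_l2[OF g]
      unfolding opmat_apply_emb[OF g] hn_norm_emb[OF g] by simp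
    have "(cmod (mform d \<phi> n m A \<eta> \<zeta>))\<^sup>2 \<le> vecs_sq n d \<eta> * vecs_sq n d (block_act d \<phi> m A \<zeta>)"
    proof -
      have "cmod (mform d \<phi> n m A \<eta> \<zeta>) \<le> (\<Sum>(i,r)\<in>{..<n}\<times>{..<d}. cmod (\<eta> i r) * cmod (block_act d \<phi> m A \<zeta> i r))"
        unfolding mform_act sum.cartesian_product
        by (rule order_trans[OF norm_sum]) (simp add: norm_mult split_def)
      then have "(cmod (mform d \<phi> n m A \<eta> \<zeta>))\<^sup>2 \<le> (\<Sum>z\<in>{..<n}\<times>{..<d}. cmod (\<eta> (fst z) (snd z)) * cmod (block_act d \<phi> m A \<zeta> (fst z) (snd z)))\<^sup>2"
        by (intro power_mono) (simp_all add: split_def)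
      also have "\<dots> \<le> (\<Sum>z\<in>{..<n}\<times>{..<d}. (cmod (\<eta> (fst z) (snd z)))\<^sup>2) * (\<Sum>z\<in>{..<n}\<times>{..<d}. (cmod (block_act d \<phi> m A \<zeta> (fst z) (snd z)))\<^sup>2)"
        by (rule Cauchy_Schwarz_ineq_sum)
      also have "\<dots> = vecs_sq n d \<eta> * vecs_sq n d (block_act d \<phi> m A \<zeta>)"
        unfolding vecs_sq_def sum.cartesian_product by (simp add: split_def)
      finally show ?thesis .
    qed
    then have "cmod (mform d \<phi> n m A \<eta> \<zeta>) \<le> sqrt (vecs_sq n d \<eta>) * sqrt (vecs_sq n d (block_act d \<phi> m A \<zeta>))"
      unfolding real_sqrt_mult[symmetric] by (rule real_le_rsqrt)
    also have "\<dots> \<le> sqrt (vecs_sq n d \<eta>) * ?M"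
      using \<open>sqrt (vecs_sq n d (block_act d \<phi> m A \<zeta>)) \<le> ?M\<close> vecs_sq_nonneg by (intro mult_left_mono) auto
    finally show ?thesis by (simp add: mult.commute)
  qed
  show ?thesis
  \<comment> \<open>The supremum runs over vectors of norm at most 1, so \<open>\<xi>\<close> is
    normalised; a zero vector is treated apart.\<close>
  proof (cases "vecs_sq m d \<xi> = 0")
    case True
    then have "\<xi> j s = 0" if "j < m" "s < d" for j s
      using that unfolding vecs_sq_def by (simp add: sum_nonneg_eq_0_iff sum_nonneg)
    then have "mform d \<phi> n m A \<eta> \<xi> = 0" unfolding mform_def by simp
    then show ?thesis using True by simp
  next
    case False
    define l where "l = sqrt (vecs_sq m d \<xi>)"
    have l: "0 < l" "l\<^sup>2 = vecs_sq m d \<xi>" using False vecs_sq_nonneg[of m d \<xi>] unfolding l_def by auto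
    define \<zeta> where "\<zeta> j s = of_real (1 / l) * \<xi> j s" for j s
    have "vecs_sq m d \<zeta> = (1 / l\<^sup>2) * vecs_sq m d \<xi>"
      unfolding vecs_sq_def \<zeta>_def sum_distrib_left using l(1) by (simp add: norm_mult norm_divide power_mult_distrib power_divide)
    then have "vecs_sq m d \<zeta> \<le> 1" unfolding l(2)[symmetric] using l(1) by simp
    from unit[OF this] have "cmod (mform d \<phi> n m A \<eta> \<zeta>) \<le> ?M * sqrt (vecs_sq n d \<eta>)" .
    moreover have "mform d \<phi> n m A \<eta> \<zeta> = of_real (1 / l) * mform d \<phi> n m A \<eta> \<xi>"
      unfolding mform_def \<zeta>_def sum_distrib_left by (simp add: ac_simps)
    ultimately have "cmod (mform d \<phi> n m A \<eta> \<xi>) / l \<le> ?M * sqrt (vecs_sq n d \<eta>)"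
      using l(1) by (simp add: norm_mult norm_divide)
    then show ?thesis using l(1) unfolding l_def[symmetric] by (simp add: field_simps)
  qed
qed

lemma mform_hat:
  assumes g: "cccp \<phi> d"
  shows "Re (mform d \<phi> (n + m) (n + m) (hat n A) \<eta> \<eta>) = 2 * Re (mform d \<phi> n m A \<eta> (\<lambda>j. \<eta> (n + j)))"
proof -
  have "mform d \<phi> (n + m) (n + m) (hat n A) \<eta> \<eta> =
      mform d \<phi> n m A \<eta> (\<lambda>j. \<eta> (n + j)) + mform d \<phi> m n (mstar st A) (\<lambda>j. \<eta> (n + j)) \<eta>"
    unfolding mform_def sum_lessThan_add hat_def mstar_def by (simp add: cccp_zero[OF g])
  then show ?thesis unfolding mform_star[OF g] by simp
qed

text \<open>\<open>nrm n m A\<close> is the norm of the self-adjoint \<open>hat n A\<close>, hence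
  at most the gauge at \<open>hat n A\<close> or at its negative. Each gauge is attained by a block
  at a vector of norm at most 1, where \<open>?M\<close> controls the form.\<close>

lemma nrm_le_opmat_norm: "nrm n m A \<le> opmat_norm idx n m (\<lambda>i j. rep (A i j))" (is "_ \<le> ?M")
proof -
  have nm: "1 \<le> n + m" using n by simp
  have H: "hat n A \<in> sa_mats st (n + m)" by (rule hat_sa[OF A])
  then have H': "- hat n A \<in> sa_mats st (n + m)" unfolding sa_mats_iff by (auto simp: st_uminus)
  have le: "\<bar>Re (mform d \<phi> (n + m) (n + m) (hat n A) \<eta> \<eta>)\<bar> \<le> ?M"
    if g: "cccp \<phi> d" and \<eta>: "vecs_sq (n + m) d \<eta> \<le> 1" for \<phi> d \<eta>
  proof -
    let ?a = "sqrt (vecs_sq n d \<eta>)" and ?b = "sqrt (vecs_sq m d (\<lambda>j. \<eta> (n + j)))"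
    have "vecs_sq (n + m) d \<eta> = vecs_sq n d \<eta> + vecs_sq m d (\<lambda>j. \<eta> (n + j))"
      unfolding vecs_sq_def sum_lessThan_add ..
    then have ab: "?a\<^sup>2 + ?b\<^sup>2 \<le> 1" using \<eta> vecs_sq_nonneg by simp
    have "\<bar>Re (mform d \<phi> (n + m) (n + m) (hat n A) \<eta> \<eta>)\<bar> \<le> 2 * cmod (mform d \<phi> n m A \<eta> (\<lambda>j. \<eta> (n + j)))"
      unfolding mform_hat[OF g] using abs_Re_le_cmod by (simp add: abs_mult)
    also have "\<dots> \<le> 2 * (?M * (?a * ?b))" using mform_le_opmat_norm[OF g] by simp
    also have "\<dots> = ?M * (2 * ?a * ?b)" by simp
    \<comment> \<open>\<open>2 a b\<close> \<le> \<open>a^2 + b^2\<close> \<le> 1 absorbs the factor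
      2 that comes from the two off-diagonal blocks.\<close>
    also have "\<dots> \<le> ?M * 1"
      using sum_squares_bound[of ?a ?b] ab opmat_norm_rep_nonneg by (intro mult_left_mono) linarith+
    finally show ?thesis by simp
  qed
  have "gauge (n + m) (0, hat n A) \<le> ?M"
  proof -
    obtain \<phi> d \<eta> where "cccp \<phi> d" "vecs_sq (n + m) d \<eta> \<le> 1"
      "Re (mform d \<phi> (n + m) (n + m) (hat n A) \<eta> \<eta>) = gauge (n + m) (0, hat n A)"
      using cccp_exists[OF nm H] by blast
    then show ?thesis using le[of \<phi> d \<eta>] by simp
  qed
  moreover have "gauge (n + m) (0, - hat n A) \<le> ?M"
  proof -
    obtain \<phi> d \<eta> where g: "cccp \<phi> d" "vecs_sq (n + m) d \<eta> \<le> 1"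
      "Re (mform d \<phi> (n + m) (n + m) (- hat n A) \<eta> \<eta>) = gauge (n + m) (0, - hat n A)"
      using cccp_exists[OF nm H'] by blast
    have "- hat n A = mscale sc (- 1) (hat n A)" unfolding mscale_def by (simp add: fun_eq_iff)
    then show ?thesis using g(3) le[OF g(1,2)] mform_scale[OF g(1), of _ _ "- 1"] by simp
  qed
  ultimately show ?thesis using nrm_le_gauge[OF nm H] nrm_hat[OF n m A] by simp
qed

lemma opmat_norm_rep: "opmat_norm idx n m (\<lambda>i j. rep (A i j)) = nrm n m A"
  using nrm_le_opmat_norm opmat_norm_rep_le by (rule antisym[rotated])

end

section \<open>Positivity under the representation\<close>

lemma opmat_pos_rep:
  assumes n: "1 \<le> n" and A: "A \<in> pos n"
  shows "opmat_pos idx n (\<lambda>i j. rep (A i j))"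
  unfolding opmat_pos_def Let_def
proof (intro allI impI)
  fix x :: "nat \<Rightarrow> (('v \<Rightarrow> nat \<Rightarrow> nat \<Rightarrow> complex) \<times> nat \<times> nat) \<Rightarrow> complex"
  assume x: "\<forall>j<n. x j \<in> l2 idx"
  define y where "y = opmat_apply n (\<lambda>i j. rep (A i j)) x"
  have A': "A \<in> mats n n" "mstar st A = A" using pos_sa[OF n A] unfolding sa_mats_def by auto
  have y: "y i \<in> l2 idx" if "i < n" for i
    unfolding y_def using opmat_rep_bound(1)[OF n n A'(1)] x that by blast
  define h where "h t = (\<Sum>i<n. y i t * cnj (x i t))" for t
  have sm: "(\<lambda>t. y i t * cnj (x i t)) summable_on idx" if "i < n" for i
    using l2_mult_summable y x that by blast
  have h: "h summable_on idx" "infsum h idx = (\<Sum>i<n. l2inner idx (y i) (x i))"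
    unfolding h_def l2inner_def using summable_on_finite_sum[of n "\<lambda>i t. y i t * cnj (x i t)" idx] sm by auto
  \<comment> \<open>On each block the terms of the inner product add up to a form of
    \<open>A\<close>.\<close>
  have blk: "(\<Sum>r<d. h (\<phi>, d, r)) = mform d \<phi> n n A (\<lambda>j s. x j (\<phi>, d, s)) (\<lambda>j s. x j (\<phi>, d, s))"
    if "cccp \<phi> d" for \<phi> d
    unfolding h_def y_def opmat_apply_rep mform_act using that by (subst sum.swap) (simp add: mult.commute)
  have real: "Im (mform d \<phi> n n A \<xi> \<xi>) = 0" if "cccp \<phi> d" for \<phi> d \<xi>
    using mform_star[OF that, of n n A \<xi> \<xi>] unfolding A'(2) by (simp add: complex_eq_iff)
  have "0 \<le> infsum (\<lambda>t. Re (h t)) idx"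
    by (rule idx_infsum_nonneg[OF summable_on_Re[OF h(1)]])
       (simp add: Re_sum[symmetric] blk cccp_pos[OF _ n A] del: Re_sum)
  \<comment> \<open>The imaginary part vanishes by two inequalities, for \<open>Im\<close> and for
    \<open>- Im\<close>.\<close>
  moreover have "0 \<le> infsum (\<lambda>t. Im (h t)) idx"
    by (rule idx_infsum_nonneg[OF summable_on_Im[OF h(1)]])
       (simp add: Im_sum[symmetric] blk real del: Im_sum)
  moreover have "0 \<le> infsum (\<lambda>t. - Im (h t)) idx"
    by (rule idx_infsum_nonneg[OF summable_on_uminus[THEN iffD2, OF summable_on_Im[OF h(1)]]])
       (simp add: Im_sum[symmetric] sum_negf blk real del: Im_sum)
  ultimately have "Im (infsum h idx) = 0 \<and> 0 \<le> Re (infsum h idx)"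
    unfolding infsum_uminus infsum_Re[OF h(1)] infsum_Im[OF h(1)] by simp
  then show "Im (\<Sum>i<n. l2inner idx (opmat_apply n (\<lambda>i j. rep (A i j)) x i) (x i)) = 0 \<and>
      0 \<le> Re (\<Sum>i<n. l2inner idx (opmat_apply n (\<lambda>i j. rep (A i j)) x i) (x i))"
    unfolding h(2) y_def .
qed

text \<open>Positivity is tested on vectors supported in the block of \<open>\<phi>\<close>.\<close>

lemma opmat_pos_mform:
  assumes p: "opmat_pos idx n (\<lambda>i j. rep (A i j))" and g: "cccp \<phi> d"
  shows "Im (mform d \<phi> n n A \<eta> \<eta>) = 0" "0 \<le> Re (mform d \<phi> n n A \<eta> \<eta>)"
proof -
  let ?x = "\<lambda>j. emb \<phi> d (\<eta> j)"
  have "l2inner idx (opmat_apply n (\<lambda>i j. rep (A i j)) ?x i) (?x i) = (\<Sum>r<d. block_act d \<phi> n A \<eta> i r * cnj (\<eta> i r))" for i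
    unfolding opmat_apply_emb[OF g] l2inner_def
    by (subst infsum_block(2)[OF g]) (auto simp: emb_def)
  then have "(\<Sum>i<n. l2inner idx (opmat_apply n (\<lambda>i j. rep (A i j)) ?x i) (?x i)) = mform d \<phi> n n A \<eta> \<eta>"
    unfolding mform_act by (simp add: mult.commute)
  moreover have "Im (\<Sum>i<n. l2inner idx (opmat_apply n (\<lambda>i j. rep (A i j)) ?x i) (?x i)) = 0 \<and>
      0 \<le> Re (\<Sum>i<n. l2inner idx (opmat_apply n (\<lambda>i j. rep (A i j)) ?x i) (?x i))"
    using p[unfolded opmat_pos_def Let_def, rule_format, of ?x] emb_l2[OF g] by blast
  ultimately show "Im (mform d \<phi> n n A \<eta> \<eta>) = 0" "0 \<le> Re (mform d \<phi> n n A \<eta> \<eta>)"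
    by (simp_all only:)
qed

lemma pos_of_opmat_pos:
  assumes n: "1 \<le> n" and A: "A \<in> mats n n" and p: "opmat_pos idx n (\<lambda>i j. rep (A i j))"
  shows "A \<in> pos n"
proof -
  note pm = opmat_pos_mform[OF p]
  define S where "S = mscale sc \<i> (A + mscale sc (- 1) (mstar st A))"
  have S: "S i j = sc \<i> (A i j - st (A j i))" for i j
    unfolding S_def mscale_def mstar_def by simp
  have "A i j = 0 \<and> A j i = 0" if "\<not> (i < n \<and> j < n)" for i j
    using A that unfolding mats_def by blast
  moreover have "st (S j i) = S i j" for i j
    unfolding S st_scale st_diff by (simp add: V.scale_right_diff_distrib)
  ultimately have S_sa: "S \<in> sa_mats st n"
    unfolding sa_mats_iff using S by (metis V.scale_zero_right diff_0_right st_zero)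
  then have S_sa': "- S \<in> sa_mats st n" unfolding sa_mats_iff by (auto simp: st_uminus)
  have zero: "mform d \<phi> n n S \<eta> \<eta> = 0" "mform d \<phi> n n (- S) \<eta> \<eta> = 0" if g: "cccp \<phi> d" for \<phi> d \<eta>
  proof -
    have "mform d \<phi> n n S \<eta> \<eta> = \<i> * (mform d \<phi> n n A \<eta> \<eta> - cnj (mform d \<phi> n n A \<eta> \<eta>))"
      unfolding S_def mform_scale[OF g] mform_add[OF g] mform_star[OF g] by simp
    also have "\<dots> = 0" using pm(1)[OF g, of \<eta>] by (simp add: complex_eq_iff)
    finally show S0: "mform d \<phi> n n S \<eta> \<eta> = 0" .
    have "- S = mscale sc (- 1) S" unfolding mscale_def by (simp add: fun_eq_iff)
    then show "mform d \<phi> n n (- S) \<eta> \<eta> = 0" using mform_scale[OF g, of n n "- 1" S \<eta> \<eta>] S0 by simp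
  qed
  have "gauge n (0, S) = 0" using cccp_exists[OF n S_sa] zero(1) by (metis zero_complex.sel(1))
  moreover have "gauge n (0, - S) = 0" using cccp_exists[OF n S_sa'] zero(2) by (metis zero_complex.sel(1))
  ultimately have "nrm n n S \<le> 0" using nrm_le_gauge[OF n S_sa] by simp
  then have "S = (\<lambda>i j. 0)"
    using nrm_nonneg[OF n n sa_mats_mats[OF S_sa]] nrm_eq_0[OF n n sa_mats_mats[OF S_sa]] by simp
  then have "sc \<i> (A i j - st (A j i)) = 0" for i j
    using S by metis
  then have "A i j - st (A j i) = 0" for i j using V.scale_eq_0_iff complex_i_not_zero by blast
  then have "st (A j i) = A i j" for i j by (metis right_minus_eq)
  then have A_sa: "A \<in> sa_mats st n" using A unfolding sa_mats_iff mats_def by blast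
  then have A_sa': "- A \<in> sa_mats st n" unfolding sa_mats_iff by (auto simp: st_uminus)
  obtain \<phi> d \<eta> where g: "cccp \<phi> d" "Re (mform d \<phi> n n (- A) \<eta> \<eta>) = gauge n (0, - A)"
    using cccp_exists[OF n A_sa'] by blast
  have "- A = mscale sc (- 1) A" unfolding mscale_def by (simp add: fun_eq_iff)
  then have "mform d \<phi> n n (- A) \<eta> \<eta> = - mform d \<phi> n n A \<eta> \<eta>"
    using mform_scale[OF g(1), of n n "- 1" A \<eta> \<eta>] by (simp only: mult_minus1)
  then have "gauge n (0, - A) \<le> 0" unfolding g(2)[symmetric] using pm(2)[OF g(1), of \<eta>] by simp
  then have "gauge n (0, - A) = 0" using gauge_nonneg[OF n] by (metis antisym)
  then show ?thesis by (rule gauge_zero_pos[OF n A_sa])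
qed

end

theorem theorem3p2:
  fixes sc :: "complex \<Rightarrow> 'v::ab_group_add \<Rightarrow> 'v"
    and st :: "'v \<Rightarrow> 'v"
    and nrm :: "nat \<Rightarrow> nat \<Rightarrow> (nat \<Rightarrow> nat \<Rightarrow> 'v) \<Rightarrow> real"
    and pos :: "nat \<Rightarrow> (nat \<Rightarrow> nat \<Rightarrow> 'v) set"
  assumes "normal_mo_star_opspace sc st nrm pos"
  shows "\<exists>(I :: (('v \<Rightarrow> nat \<Rightarrow> nat \<Rightarrow> complex) \<times> nat \<times> nat) set)
            (\<phi> :: 'v \<Rightarrow> (((('v \<Rightarrow> nat \<Rightarrow> nat \<Rightarrow> complex) \<times> nat \<times> nat) \<Rightarrow> complex)
                       \<Rightarrow> ((('v \<Rightarrow> nat \<Rightarrow> nat \<Rightarrow> complex) \<times> nat \<times> nat) \<Rightarrow> complex))).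
           linear_into_B sc I \<phi> \<and>
           (\<forall>n m A. 1 \<le> n \<longrightarrow> 1 \<le> m \<longrightarrow> A \<in> mats n m \<longrightarrow>
              opmat_norm I n m (\<lambda>i j. \<phi> (A i j)) = nrm n m A) \<and>
           (\<forall>n A. 1 \<le> n \<longrightarrow> A \<in> mats n n \<longrightarrow>
              (opmat_pos I n (\<lambda>i j. \<phi> (A i j)) \<longleftrightarrow> A \<in> pos n))"
proof -
  interpret normal_space sc st nrm pos by unfold_locales (rule assms)
  show ?thesis
    using rep_linear_into_B opmat_norm_rep opmat_pos_rep pos_of_opmat_pos by blast
qed

end
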